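(* (Asymptotic linear convergence of MSA for logit-based SUE.) Let $\hat{\mathbf h}$ denote the logit-based stochastic user equilibrium (SUE) path flow solution, i.e. the feasible path flow vector with $\hat{\mathbf h}=\mathcal{L}(\hat{\mathbf h})$, and let $\{\mathbf h^k\}$ be the sequence of feasible iterates generated by the method of successive averages (MSA) update $$\mathbf{h}^{k+1}=(1-s)\mathbf{h}^k+s\,\mathcal{L}(\mathbf{h}^k)$$ with constant step-size $s\in(0,1)$. Assume the link cost functions are monotone non-decreasing. Then, in a neighborhood of $\hat{\mathbf h}$, MSA converges linearly to $\hat{\mathbf h}$ for any step-size satisfying $$0<s<\frac{2}{2-\lambda_{\min}}=:s_g,$$ where $\lambda_{\min}$ is the smallest (most negative) eigenvalue of $\mathcal{K}(\hat{\mathbf h})$. Moreover, convergence is guaranteed whenever $$0<s<\frac{2}{2+\theta\,\bigl(\max_{OD}d_{OD}\bigr)\,\|\mathcal{C}'(\hat{\mathbf h})\|}\ \le\ s_g .$$ Under these conditions, the asymptotic rate of convergence of the MSA iterates $\{\mathbf h^k\}$ to $\hat{\mathbf h}$ is $$r^*(s)=1-s .$$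
   Context: Network setting. There is a finite set $\mathbb{L}$ of links and a finite nonempty set of origin-destination (OD) pairs. Each OD pair has a demand $d_{OD}\ge 0$ and a fixed finite nonempty set $\mathbb{P}_{OD}$ of acyclic paths; $\mathbb{P}$ is the disjoint union of the $\mathbb{P}_{OD}$, $n=|\mathbb{P}|$, and $OD(i)$ is the OD pair of path $i$. $\mathbf{D}\in\{0,1\}^{|\mathbb{L}|\times n}$ is the link-path incidence matrix ($D_{li}=1$ iff link $l$ is on path $i$). A vector $\mathbf{h}\in\mathbb{R}^n$ is a feasible path flow vector if $h_i\ge 0$ for all $i$ and $\sum_{i\in\mathbb{P}_{OD}}h_i=d_{OD}$ for every OD pair. Costs. The cost of link $l$ depends only on its own flow $a_l$ via $\tau_l:[0,\infty)\to[0,\infty)$, which is twice continuously differentiable and monotone non-decreasing, with $\tau_l'$ Lipschitz on the bounded set of link flows arising from feasible path flows. Link flows are $\mathbf a=\mathbf D\mathbf h$, path costs are $\mathcal{C}(\mathbf h)=\mathbf{D}^T\mathcal{T}(\mathbf{D}\mathbf{h})$ with $\mathcal{T}_l(\mathbf a)=\tau_l(a_l)$, and the Jacobian is $\mathcal{C}'(\mathbf h)=\mathbf D^T\operatorname{diag}(\tau_l'(a_l))\mathbf D$. Logit model. $\theta>0$ is a fixed parameter. For a path cost vector $\mathbf c$, $\mathcal{P}(\mathbf c)_i=\exp(-\theta c_i)/\sum_{i'\in\mathbb{P}_{OD(i)}}\exp(-\theta c_{i'})$. Put $\mathcal{H}(\mathbf h,\mathbf p)_i=\bigl(\sum_{i'\in\mathbb{P}_{OD(i)}}h_{i'}\bigr)p_i$.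 The logit mapping is $\mathcal{L}(\mathbf h)=\mathcal{H}(\mathbf h,\mathcal{P}(\mathcal{C}(\mathbf h)))$. $\mathcal{P}'(\mathbf c)$ is the Jacobian of $\mathcal{P}$, and $\mathcal{H}'_{\mathbf p}(\mathbf h)$ is the Jacobian of $\mathcal{H}$ in $\mathbf p$ with $\mathbf h$ fixed (for feasible $\mathbf h$, the diagonal matrix with entries $d_{OD(i)}$). The reduced Jacobian is $\mathcal{K}(\mathbf h)=\mathcal{H}'_{\mathbf p}(\mathbf h)\,\mathcal{P}'(\mathbf c)\,\mathcal{C}'(\mathbf h)$ with $\mathbf c=\mathcal{C}(\mathbf h)$; at feasible $\mathbf h$ its eigenvalues are real and non-positive, the largest is $0$, and the smallest is at least $-\theta\,(\max_{OD}d_{OD})\,\|\mathcal{C}'(\mathbf h)\|$. It is known (Fisk) that the feasible fixed point $\hat{\mathbf h}$ of $\mathcal{L}$ exists and is unique. $\|\cdot\|$ is the $\ell_2$ norm and its induced matrix (spectral) norm. The asymptotic rate of convergence of the iterates is the factor by which the error $\|\mathbf h^k-\hat{\mathbf h}\|$ shrinks per iteration as $k\to\infty$, i.e. the value at which the ratio $\|\mathbf h^{k}-\hat{\mathbf h}\|/\|\mathbf h^{k-1}-\hat{\mathbf h}\|$ settles.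
   Formalization: The claim that the rate is exactly 1-s fails for some networks; replaced by: error at most C(1-s)^k; its ratio tends to 1-s or the error is o((1-s)^k); (1-s)I+sK has spectral radius 1-s; ratio 1-s for generic starts if K has a feasible kernel direction. *)

theory Defs
  imports "HOL-Analysis.Analysis" "Graph_Theory.Arc_Walk"
begin

text \<open>
  Links, paths and OD pairs are the elements of the finite types 'l, 'n and 'o.  The path set of
  an OD pair \<open>w\<close> is \<open>{i. od i = w}\<close>, so the path sets are disjoint by construction and \<open>n = CARD('n)\<close>.
\<close>

definition incidence :: "('n \<Rightarrow> 'l list) \<Rightarrow> real^'n^'l" where
  "incidence route = (\<chi> l i. if l \<in> set (route i) then 1 else 0)"

definition feasible :: "('n::finite \<Rightarrow> 'o) \<Rightarrow> ('o \<Rightarrow> real) \<Rightarrow> (real^'n) set" where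
  "feasible od d = {h. (\<forall>i. 0 \<le> h $ i) \<and> (\<forall>w. (\<Sum>i | od i = w. h $ i) = d w)}"

definition link_costs :: "('l \<Rightarrow> real \<Rightarrow> real) \<Rightarrow> real^'l \<Rightarrow> real^'l" where
  "link_costs \<tau> a = (\<chi> l. \<tau> l (a $ l))"

definition path_costs :: "real^'n^'l \<Rightarrow> ('l::finite \<Rightarrow> real \<Rightarrow> real) \<Rightarrow> real^'n \<Rightarrow> real^'n" where
  "path_costs D \<tau> h = transpose D *v link_costs \<tau> (D *v h)"

text \<open>
  \<open>\<tau>'\<close> is the derivative of \<open>\<tau>\<close>, one-sided at \<open>0\<close>.  The link costs are only given on \<open>[0, \<infinity>)\<close>, so the
  path costs need not be differentiable on a full neighbourhood of a feasible point and the
  Jacobian is given by its formula.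
\<close>

definition path_costs_jacobian ::
    "real^'n^'l \<Rightarrow> ('l::finite \<Rightarrow> real \<Rightarrow> real) \<Rightarrow> real^'n \<Rightarrow> real^'n^'n" where
  "path_costs_jacobian D \<tau>' h =
     transpose D ** (\<chi> l m. if l = m then \<tau>' l ((D *v h) $ l) else 0) ** D"

definition logit_choice :: "real \<Rightarrow> ('n::finite \<Rightarrow> 'o) \<Rightarrow> real^'n \<Rightarrow> real^'n" where
  "logit_choice \<theta> od c =
     (\<chi> i. exp (- \<theta> * c $ i) / (\<Sum>j | od j = od i. exp (- \<theta> * c $ j)))"

definition demand_split :: "('n::finite \<Rightarrow> 'o) \<Rightarrow> real^'n \<Rightarrow> real^'n \<Rightarrow> real^'n" where
  "demand_split od h p = (\<chi> i. (\<Sum>j | od j = od i. h $ j) * p $ i)"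

definition logit_map ::
    "real \<Rightarrow> ('n::finite \<Rightarrow> 'o) \<Rightarrow> real^'n^'l \<Rightarrow> ('l::finite \<Rightarrow> real \<Rightarrow> real) \<Rightarrow> real^'n \<Rightarrow> real^'n" where
  "logit_map \<theta> od D \<tau> h = demand_split od h (logit_choice \<theta> od (path_costs D \<tau> h))"

definition reduced_jacobian ::
    "real \<Rightarrow> ('n::finite \<Rightarrow> 'o) \<Rightarrow> real^'n^'l \<Rightarrow> ('l::finite \<Rightarrow> real \<Rightarrow> real) \<Rightarrow> ('l \<Rightarrow> real \<Rightarrow> real) \<Rightarrow>
     real^'n \<Rightarrow> real^'n^'n" where
  "reduced_jacobian \<theta> od D \<tau> \<tau>' h =
     (let c = path_costs D \<tau> h in
        jacobian (demand_split od h) (at (logit_choice \<theta> od c)) **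
        jacobian (logit_choice \<theta> od) (at c) **
        path_costs_jacobian D \<tau>' h)"

definition msa_step :: "('a::real_vector \<Rightarrow> 'a) \<Rightarrow> real \<Rightarrow> 'a \<Rightarrow> 'a" where
  "msa_step L s h = (1 - s) *\<^sub>R h + s *\<^sub>R L h"

definition msa :: "('a::real_vector \<Rightarrow> 'a) \<Rightarrow> real \<Rightarrow> 'a \<Rightarrow> nat \<Rightarrow> 'a" where
  "msa L s h k = (msa_step L s ^^ k) h"

definition real_eigenvalues :: "real^'n^'n \<Rightarrow> real set" where
  "real_eigenvalues A = {x. \<exists>v. v \<noteq> 0 \<and> A *v v = x *\<^sub>R v}"

text \<open>
  The constant is needed because the error of a linear iteration with a non-normal matrix can grow
  in the Euclidean norm before it decays at the rate given by the eigenvalues.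
\<close>

definition converges_linearly :: "(nat \<Rightarrow> 'a::real_normed_vector) \<Rightarrow> 'a \<Rightarrow> bool" where
  "converges_linearly x l \<longleftrightarrow>
     (\<exists>r C. 0 \<le> r \<and> r < 1 \<and> (\<forall>k. norm (x k - l) \<le> C * r ^ k))"

definition asymptotic_rate :: "(nat \<Rightarrow> 'a::real_normed_vector) \<Rightarrow> 'a \<Rightarrow> real \<Rightarrow> bool" where
  "asymptotic_rate x l r \<longleftrightarrow> (\<lambda>k. norm (x (Suc k) - l) / norm (x k - l)) \<longlonglongrightarrow> r"

text \<open>Convergence of strictly higher order than \<open>r\<^sup>k\<close>; this includes reaching \<open>l\<close> in finitely many steps.\<close>

definition converges_faster :: "(nat \<Rightarrow> 'a::real_normed_vector) \<Rightarrow> 'a \<Rightarrow> real \<Rightarrow> bool" where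
  "converges_faster x l r \<longleftrightarrow> (\<lambda>k. norm (x k - l) / r ^ k) \<longlonglongrightarrow> 0"

locale logit_network = fin_digraph G
  for G :: "('v, 'l::finite) pre_digraph" +
  fixes origin destination :: "'o::finite \<Rightarrow> 'v"
    and od :: "'n::finite \<Rightarrow> 'o"
    and route :: "'n \<Rightarrow> 'l list"
    and d :: "'o \<Rightarrow> real"
    and \<tau> \<tau>' \<tau>'' :: "'l \<Rightarrow> real \<Rightarrow> real"
    and \<theta> :: real
  assumes links: "arcs G = UNIV"
    and od_pairs_distinct: "inj (\<lambda>w. (origin w, destination w))"
    and paths_acyclic: "apath (origin (od i)) (route i) (destination (od i))"
    and paths_distinct: "inj (\<lambda>i. (od i, route i))"
    and paths_nonempty: "surj od"
    and demand_nonneg: "0 \<le> d w"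
    and cost_nonneg: "0 \<le> a \<Longrightarrow> 0 \<le> \<tau> l a"
    and cost_mono: "mono_on {0..} (\<tau> l)"
    and cost_deriv: "0 \<le> a \<Longrightarrow> (\<tau> l has_real_derivative \<tau>' l a) (at a within {0..})"
    and cost_deriv2: "0 \<le> a \<Longrightarrow> (\<tau>' l has_real_derivative \<tau>'' l a) (at a within {0..})"
    and cost_deriv2_cont: "continuous_on {0..} (\<tau>'' l)"
    and cost_deriv_lipschitz:
      "\<exists>K. K-lipschitz_on ((\<lambda>h. (incidence route *v h) $ l) ` feasible od d) (\<tau>' l)"
    and theta_pos: "0 < \<theta>"

end

theory Submission
  imports Defs
begin

text \<open>
  On the space \<open>T\<close> of differences of feasible flows the matrix \<open>- K\<close> is symmetric and positive semidefinite
  for the inner product with weights \<open>1 / (\<theta> * hh $ i)\<close>.  Hence the linearized step \<open>(1 - s) I + s K\<close>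
  contracts by the factor \<open>1 - s\<close> in the weighted norm as long as \<open>s * (2 - lmin) \<le> 2\<close>, and the
  quadratic remainder of the logit map changes this only by a convergent product.

  For \<open>s * (2 - lmin) < 2\<close> the rescaled errors \<open>(h\<^sup>k - hh) / (1 - s)\<^sup>k\<close> converge, by Opial's argument.
  Where the limit is nonzero the error ratio tends to \<open>1 - s\<close>; where it vanishes the convergence is faster.
  The limit is a Lipschitz function of the starting point with derivative close to the identity along the
  kernel of \<open>K\<close>, so that it is nonzero on an open dense set if this kernel meets the feasible
  directions.
\<close>

section \<open>Damped iterations near a fixed point\<close>

text \<open>The weights are the Hessian of the entropy term of Fisk's objective at the equilibrium,
  and the path cost Jacobian is the Hessian of the summed link cost integrals; this is why
  \<open>K\<close> is symmetric in that metric although in general it is not in the Euclidean one.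
  The step-size bound appears when the linearized step is written as (1 - s)(I - \<kappa> A) with A
  = - K and \<kappa> = s / (1 - s): the condition \<kappa> (- lmin) < 2 is s (2 - lmin) < 2. The
  exact rate is harder than the upper bound. Components off the kernel of \<open>K\<close> decay
  faster than (1 - s)^k, but the remainder can create or cancel kernel components at every step, so
  the kernel part of the starting error does not decide the rate. Hence two orbits are compared with
  each other, and remainder estimates are stated for pairs of points. They live on the feasible set
  only, because link costs are controlled only for nonnegative flows.\<close>

lemma almost_decreasing_convergent:
  fixes a r :: "nat \<Rightarrow> real"
  assumes "\<And>k. 0 \<le> a k" "\<And>k. 0 \<le> r k" "\<And>k. a (Suc k) \<le> a k + r k" "summable r"
  shows "convergent a"
proof -
  \<comment> \<open>Removing the accumulated perturbations leaves a decreasing sequence, bounded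
    below because their total is finite.\<close>
  define b where "b k = a k - (\<Sum>j<k. r j)" for k
  have "decseq b"
    by (rule decseq_SucI) (use assms(3) in \<open>simp add: b_def algebra_simps\<close>)
  moreover have "- suminf r \<le> b k" for k
    using sum_le_suminf[OF assms(4), of "{..<k}"] assms(1)[of k] assms(2) by (simp add: b_def)
  ultimately obtain l where "b \<longlonglongrightarrow> l"
    using decseq_convergent by blast
  moreover have "(\<lambda>k. \<Sum>j<k. r j) \<longlonglongrightarrow> suminf r"
    using assms(4) by (rule summable_LIMSEQ)
  ultimately have "(\<lambda>k. b k + (\<Sum>j<k. r j)) \<longlonglongrightarrow> l + suminf r"
    by (rule tendsto_add)
  then show ?thesis
    by (auto simp: b_def convergent_def)
qed

section \<open>Operators symmetric for a weighted inner product\<close>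

text \<open>The inner product is carried by the injective map \<open>S\<close>, as <S x, S y>, so
  that Euclidean facts apply directly. Symmetry is demanded only on the invariant subspace
  \<open>T\<close>; elsewhere the reduced Jacobian need not be symmetric.\<close>

locale symmetric_operator =
  fixes S A :: "'a::euclidean_space \<Rightarrow> 'a" and T :: "'a set"
  assumes S: "linear S" "inj S"
    and A: "linear A"
    and T: "subspace T"
    and A_in: "x \<in> T \<Longrightarrow> A x \<in> T"
    and A_sym: "x \<in> T \<Longrightarrow> y \<in> T \<Longrightarrow> S x \<bullet> S (A y) = S (A x) \<bullet> S y"
begin

abbreviation N :: "'a \<Rightarrow> real" where "N x \<equiv> norm (S x)"

lemmas S_simps = linear_add[OF S(1)] linear_diff[OF S(1)] linear_scale[OF S(1)]
lemmas A_simps = linear_add[OF A] linear_diff[OF A] linear_scale[OF A]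

lemma N_add: "N (x + y) \<le> N x + N y"
  by (simp add: S_simps norm_triangle_ineq)

lemma N_le_add_diff: "N x \<le> N y + N (x - y)"
  using N_add[of y "x - y"] by simp

lemma N_scale: "N (c *\<^sub>R x) = \<bar>c\<bar> * N x"
  by (simp add: S_simps)

lemma S_eq_0_iff: "S x = 0 \<longleftrightarrow> x = 0"
  using S linear_injective_0 linear_0 by blast

lemma N_le: obtains b where "b > 0" "\<And>x. N x \<le> b * norm x"
  using linear_bounded_pos[OF S(1)] by blast

lemma le_N: obtains b where "b > 0" "\<And>x. norm x \<le> b * N x"
proof -
  obtain B where B: "B > 0" "\<And>x. B * norm x \<le> N x"
    using linear_inj_bounded_below_pos[OF S] by blast
  show ?thesis
    by (rule that[of "1/B"]) (use B in \<open>auto simp: field_simps\<close>)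
qed

lemma tendsto_N: "f \<longlonglongrightarrow> l \<Longrightarrow> (\<lambda>k. N (f k)) \<longlonglongrightarrow> N l"
  by (intro tendsto_norm bounded_linear.tendsto[OF linear_conv_bounded_linear[THEN iffD1, OF S(1)]])

lemma tendsto_N_0: "(\<lambda>k. N (f k - l)) \<longlonglongrightarrow> 0 \<Longrightarrow> f \<longlonglongrightarrow> l"
proof -
  assume *: "(\<lambda>k. N (f k - l)) \<longlonglongrightarrow> 0"
  obtain b where b: "b > 0" "\<And>x. norm x \<le> b * N x" by (rule le_N) blast
  have "(\<lambda>k. norm (f k - l)) \<longlonglongrightarrow> 0"
    by (rule tendsto_sandwich[of "\<lambda>_. 0" _ _ "\<lambda>k. b * N (f k - l)"])
       (use b tendsto_mult_right_zero[OF *] in auto)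
  then show ?thesis by (simp add: LIM_zero_iff tendsto_norm_zero_iff)
qed

text \<open>The Rayleigh quotient attains its maximum on the compact unit sphere of
  \<open>T\<close>, and the first-order condition at a maximizer is the eigenvector
  equation.\<close>

lemma top_eigenvector:
  assumes "T \<noteq> {0}"
  obtains v \<mu> where "v \<in> T" "v \<noteq> 0" "A v = \<mu> *\<^sub>R v"
    "\<And>x. x \<in> T \<Longrightarrow> S x \<bullet> S (A x) \<le> \<mu> * (N x)\<^sup>2"
proof -
  define f where "f x = S x \<bullet> S (A x)" for x
  define U where "U = T \<inter> {x. N x = 1}"
  have cont: "continuous_on X S" "continuous_on X A" for X
    using S(1) A linear_continuous_on linear_conv_bounded_linear by blast+
  have contSA: "continuous_on X (\<lambda>x. S (A x))" for X
    using continuous_on_compose2[OF cont(1)[of UNIV] cont(2)[of X]] by simp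
  obtain b where b: "b > 0" "\<And>x. norm x \<le> b * N x" by (rule le_N) blast
  have "norm x \<le> b" if "x \<in> U" for x
    using b(2)[of x] that by (simp add: U_def)
  then have "bounded U" by (auto simp: bounded_iff)
  moreover have "closed U"
    unfolding U_def
    by (intro closed_Int closed_subspace T closed_Collect_eq continuous_on_norm cont continuous_on_const)
  ultimately have "compact U" by (simp add: compact_eq_bounded_closed)
  obtain x0 where x0: "x0 \<in> T" "x0 \<noteq> 0" using assms subspace_0[OF T] by blast
  have normalized: "x /\<^sub>R N x \<in> U" if "x \<in> T" "x \<noteq> 0" for x
    using that T by (simp add: U_def N_scale S_eq_0_iff subspace_scale)
  have "\<exists>v\<in>U. \<forall>x\<in>U. f x \<le> f v"
    unfolding f_def using normalized[OF x0]
    by (intro continuous_attains_sup \<open>compact U\<close> continuous_on_inner cont contSA) auto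
  then obtain v where v: "v \<in> U" "\<And>x. x \<in> U \<Longrightarrow> f x \<le> f v" by blast
  define \<mu> where "\<mu> = f v"
  have vT: "v \<in> T" and Nv: "N v = 1" using v(1) by (auto simp: U_def)
  have le: "f x \<le> \<mu> * (N x)\<^sup>2" if x: "x \<in> T" for x
  proof (cases "x = 0")
    case True
    then show ?thesis by (simp add: f_def linear_0[OF S(1)])
  next
    case False
    then have "(N x)\<^sup>2 > 0" by (simp add: S_eq_0_iff)
    moreover have "f (x /\<^sub>R N x) = f x / (N x)\<^sup>2"
      by (simp add: f_def A_simps S_simps power2_eq_square divide_inverse)
    then have "f x / (N x)\<^sup>2 \<le> \<mu>"
      using v(2)[OF normalized[OF x False]] by (simp only: \<mu>_def)
    ultimately show ?thesis by (simp only: pos_divide_le_eq)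
  qed
  \<comment> \<open>The residual of the eigenvector equation serves as direction of variation: the
    linear coefficient of the Rayleigh gap along it is twice its squared norm
    \<open>n\<close>.\<close>
  define w where "w = \<mu> *\<^sub>R v - A v"
  have wT: "w \<in> T" unfolding w_def using vT A_in T by (intro subspace_diff subspace_scale)
  define n where "n = S w \<bullet> S w"
  define m where "m = \<mu> * (S w \<bullet> S w) - f w"
  have quad: "0 \<le> 2 * t * n + t\<^sup>2 * m" for t
  proof -
    have "v + t *\<^sub>R w \<in> T" using vT wT T by (intro subspace_add subspace_scale)
    from le[OF this] have "0 \<le> \<mu> * (S (v + t *\<^sub>R w) \<bullet> S (v + t *\<^sub>R w)) - f (v + t *\<^sub>R w)"
      by (simp add: power2_norm_eq_inner)
    also have "\<dots> = (\<mu> * (S v \<bullet> S v) - f v) + 2 * t * (\<mu> * (S v \<bullet> S w) - S v \<bullet> S (A w)) + t\<^sup>2 * m"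
      using A_sym[OF wT vT]
      by (simp add: f_def m_def S_simps A_simps inner_add_left inner_add_right
          power2_eq_square algebra_simps inner_commute)
    also have "\<mu> * (S v \<bullet> S v) - f v = 0"
      using Nv by (simp add: \<mu>_def norm_eq_1)
    also have "\<mu> * (S v \<bullet> S w) - S v \<bullet> S (A w) = n"
      using A_sym[OF vT wT] by (simp add: n_def w_def S_simps inner_diff_left)
    finally show ?thesis by simp
  qed
  \<comment> \<open>Since \<open>M\<close> exceeds the modulus of \<open>m\<close>, the linear term
    dominates at t = - n / M and would make the gap negative unless n = 0.\<close>
  define M where "M = \<bar>m\<bar> + 1"
  have M: "M > 0" by (simp add: M_def)
  have "0 \<le> 2 * (- n / M) * n + (- n / M)\<^sup>2 * m" by (rule quad)
  also have "\<dots> = n\<^sup>2 * (m - 2 * M) / M\<^sup>2"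
    using M by (simp add: field_simps power2_eq_square)
  finally have "0 \<le> n\<^sup>2 * (m - 2 * M)" using M by (simp add: zero_le_divide_iff)
  moreover have "m - 2 * M < 0" by (simp add: M_def abs_if)
  ultimately have "n = 0" by (simp add: zero_le_mult_iff)
  then have "A v = \<mu> *\<^sub>R v" by (simp add: n_def S_eq_0_iff w_def)
  moreover have "v \<noteq> 0" using Nv linear_0[OF S(1)] by auto
  ultimately show thesis using that vT le by (auto simp: f_def)
qed

end

section \<open>Damped steps with a positive semidefinite operator\<close>

locale psd_operator = symmetric_operator S A T
  for S A :: "'a::euclidean_space \<Rightarrow> 'a" and T :: "'a set" +
  fixes \<mu> :: real
  assumes A_nonneg: "x \<in> T \<Longrightarrow> 0 \<le> S x \<bullet> S (A x)"
    and A_bound: "x \<in> T \<Longrightarrow> S x \<bullet> S (A x) \<le> \<mu> * (norm (S x))\<^sup>2"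
begin

text \<open>This is A^2 <= \<mu> A for the quadratic forms on \<open>T\<close>. It follows from
  nonnegativity of the form of \<open>A\<close> at x - t A x with t = 1 / \<mu>.\<close>

lemma norm_A_sq_le:
  assumes "x \<in> T"
  shows "(N (A x))\<^sup>2 \<le> \<mu> * (S x \<bullet> S (A x))"
proof -
  define n where "n = (N (A x))\<^sup>2"
  define q where "q = S x \<bullet> S (A x)"
  define p where "p = S (A x) \<bullet> S (A (A x))"
  have p: "p \<le> \<mu> * n"
    using A_bound[OF A_in[OF assms]] by (simp add: p_def n_def)
  have q: "0 \<le> q" using A_nonneg[OF assms] by (simp add: q_def)
  have n: "0 \<le> n" by (simp add: n_def)
  have n_inner: "n = S (A x) \<bullet> S (A x)" by (simp add: n_def power2_norm_eq_inner)
  have quad: "0 \<le> q - 2 * t * n + t\<^sup>2 * p" for t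
  proof -
    have "x - t *\<^sub>R A x \<in> T"
      using assms A_in T by (meson subspace_diff subspace_scale)
    from A_nonneg[OF this] show ?thesis
      using A_sym[OF assms A_in[OF assms]]
      by (simp add: S_simps A_simps inner_diff_left inner_diff_right n_inner q_def p_def
          power2_eq_square algebra_simps)
  qed
  have "n \<le> \<mu> * q"
  proof (cases "\<mu> > 0")
    case True
    have "0 \<le> q - 2 * (1/\<mu>) * n + (1/\<mu>)\<^sup>2 * p" by (rule quad)
    also have "\<dots> \<le> q - 2 * (1/\<mu>) * n + (1/\<mu>)\<^sup>2 * (\<mu> * n)"
      using p by (intro add_left_mono mult_left_mono) auto
    also have "\<dots> = q - n / \<mu>" using True by (simp add: field_simps power2_eq_square)
    finally show ?thesis using True by (simp add: field_simps)
  next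
    \<comment> \<open>A nonnegative form bounded by a nonpositive one vanishes at \<open>x\<close>;
      then t = 1 forces A x = 0.\<close>
    case False
    have "q \<le> \<mu> * (N x)\<^sup>2" using A_bound[OF assms] by (simp add: q_def)
    also have "\<dots> \<le> 0" using False by (intro mult_nonpos_nonneg) auto
    finally have q0: "q = 0" using q by simp
    have "p \<le> 0" using p n False by (meson mult_nonpos_nonneg not_less order_trans)
    then have "n \<le> 0" using quad[of 1] q0 by simp
    then show ?thesis using q0 n by simp
  qed
  then show ?thesis by (simp add: n_def q_def)
qed

text \<open>The loss is a multiple of the energy <S x, S (A x)>, with positive factor when 0 <
  \<kappa> and \<kappa> \<mu> < 2. It gives nonexpansiveness and, once the norms converge, forces
  the energy to 0.\<close>

lemma damped_step_sq:
  assumes "x \<in> T" "0 \<le> \<kappa>"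
  shows "(N (x - \<kappa> *\<^sub>R A x))\<^sup>2 \<le> (N x)\<^sup>2 - \<kappa> * (2 - \<kappa> * \<mu>) * (S x \<bullet> S (A x))"
proof -
  have "(N (x - \<kappa> *\<^sub>R A x))\<^sup>2 = (N x)\<^sup>2 - 2 * \<kappa> * (S x \<bullet> S (A x)) + \<kappa>\<^sup>2 * (N (A x))\<^sup>2"
    unfolding power2_norm_eq_inner
    by (simp add: S_simps inner_diff_left inner_diff_right power2_eq_square algebra_simps inner_commute)
  also have "\<dots> \<le> (N x)\<^sup>2 - 2 * \<kappa> * (S x \<bullet> S (A x)) + \<kappa>\<^sup>2 * (\<mu> * (S x \<bullet> S (A x)))"
    by (intro add_left_mono mult_left_mono norm_A_sq_le assms) auto
  also have "\<dots> = (N x)\<^sup>2 - \<kappa> * (2 - \<kappa> * \<mu>) * (S x \<bullet> S (A x))"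
    by (simp add: algebra_simps power2_eq_square)
  finally show ?thesis .
qed

lemma damped_step_le:
  assumes "x \<in> T" "0 \<le> \<kappa>" "\<kappa> * \<mu> \<le> 2"
  shows "N (x - \<kappa> *\<^sub>R A x) \<le> N x"
proof -
  have "0 \<le> \<kappa> * (2 - \<kappa> * \<mu>) * (S x \<bullet> S (A x))"
    using assms A_nonneg[OF assms(1)] by simp
  with damped_step_sq[OF assms(1,2)] have "(N (x - \<kappa> *\<^sub>R A x))\<^sup>2 \<le> (N x)\<^sup>2" by linarith
  then show ?thesis by (rule power2_le_imp_le) simp
qed

text \<open>
  Opial's argument: the energy \<open>\<langle>S y, S (A y)\<rangle>\<close> tends to \<open>0\<close>, so every cluster point is a fixed
  point of the linear step, and the distance to a fixed point is almost decreasing.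
\<close>

lemma perturbed_damped_iteration_convergent:
  fixes y :: "nat \<Rightarrow> 'a"
  assumes y: "\<And>k. y k \<in> T"
    and \<kappa>: "0 < \<kappa>" "\<kappa> * \<mu> < 2"
    and r: "\<And>k. N (y (Suc k) - (y k - \<kappa> *\<^sub>R A (y k))) \<le> r k" "summable r"
  shows "convergent y"
proof -
  have r0: "0 \<le> r k" for k using r(1)[of k] norm_ge_zero order_trans by blast
  have step: "N (y (Suc k) - l) \<le> N (y k - l) + r k" if l: "l \<in> T" "A l = 0" for l k
  proof -
    have "y (Suc k) - l = ((y k - l) - \<kappa> *\<^sub>R A (y k - l)) + (y (Suc k) - (y k - \<kappa> *\<^sub>R A (y k)))"
      using l by (simp add: A_simps)
    then have "N (y (Suc k) - l) \<le>
        N ((y k - l) - \<kappa> *\<^sub>R A (y k - l)) + N (y (Suc k) - (y k - \<kappa> *\<^sub>R A (y k)))"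
      by (simp only: N_add)
    also have "\<dots> \<le> N ((y k - l) - \<kappa> *\<^sub>R A (y k - l)) + r k"
      using r(1)[of k] by simp
    also have "N ((y k - l) - \<kappa> *\<^sub>R A (y k - l)) \<le> N (y k - l)"
      using \<kappa> y l T by (intro damped_step_le) (auto simp: subspace_diff)
    finally show ?thesis by simp
  qed
  have conv: "convergent (\<lambda>k. N (y k - l))" if "l \<in> T" "A l = 0" for l
    using almost_decreasing_convergent[of "\<lambda>k. N (y k - l)" r] step[OF that] r0 r(2) by auto
  obtain L where L: "(\<lambda>k. N (y k)) \<longlonglongrightarrow> L"
    using conv[of 0] T A by (auto simp: subspace_0 linear_0 convergent_def)
  have r_lim: "r \<longlonglongrightarrow> 0" using r(2) by (rule summable_LIMSEQ_zero)
  \<comment> \<open>Squeezed between two consecutive norms, the linear step alone loses nothing in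
    the limit.\<close>
  have "(\<lambda>k. N (y k - \<kappa> *\<^sub>R A (y k))) \<longlonglongrightarrow> L"
  proof (rule tendsto_sandwich[of "\<lambda>k. N (y (Suc k)) - r k" _ _ "\<lambda>k. N (y k)"])
    have "N (y (Suc k)) \<le> N (y k - \<kappa> *\<^sub>R A (y k)) + r k" for k
      using N_le_add_diff[of "y (Suc k)" "y k - \<kappa> *\<^sub>R A (y k)"] r(1)[of k] by linarith
    then show "\<forall>\<^sub>F k in sequentially. N (y (Suc k)) - r k \<le> N (y k - \<kappa> *\<^sub>R A (y k))"
      by (simp add: diff_le_eq)
    show "\<forall>\<^sub>F k in sequentially. N (y k - \<kappa> *\<^sub>R A (y k)) \<le> N (y k)"
      using damped_step_le[OF y] \<kappa> by simp
    show "(\<lambda>k. N (y (Suc k)) - r k) \<longlonglongrightarrow> L"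
      using tendsto_diff[OF LIMSEQ_Suc[OF L] r_lim] by simp
  qed (rule L)
  from tendsto_diff[OF tendsto_power[OF L, of 2] tendsto_power[OF this, of 2]]
  have gap: "(\<lambda>k. (N (y k))\<^sup>2 - (N (y k - \<kappa> *\<^sub>R A (y k)))\<^sup>2) \<longlonglongrightarrow> 0" by simp
  define \<gamma> where "\<gamma> = \<kappa> * (2 - \<kappa> * \<mu>)"
  have \<gamma>: "\<gamma> > 0" using \<kappa> by (simp add: \<gamma>_def)
  \<comment> \<open>The loss of squared norm controls the energy, which in turn controls A y. The
    modulus of \<mu> keeps the factor nonnegative.\<close>
  have A_le: "(N (A (y k)))\<^sup>2 \<le> \<bar>\<mu>\<bar> / \<gamma> * ((N (y k))\<^sup>2 - (N (y k - \<kappa> *\<^sub>R A (y k)))\<^sup>2)" for k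
  proof -
    have "(N (A (y k)))\<^sup>2 \<le> \<bar>\<mu>\<bar> * (S (y k) \<bullet> S (A (y k)))"
      using norm_A_sq_le[OF y[of k]] A_nonneg[OF y[of k]] abs_ge_self mult_right_mono order_trans by meson
    also have "S (y k) \<bullet> S (A (y k)) \<le> ((N (y k))\<^sup>2 - (N (y k - \<kappa> *\<^sub>R A (y k)))\<^sup>2) / \<gamma>"
      using damped_step_sq[OF y[of k], of \<kappa>] \<kappa> \<gamma> by (simp add: field_simps flip: \<gamma>_def)
    finally show ?thesis by (simp add: mult_left_mono)
  qed
  have "(\<lambda>k. (N (A (y k)))\<^sup>2) \<longlonglongrightarrow> 0"
    by (rule tendsto_sandwich[OF _ _ tendsto_const tendsto_mult_right_zero[OF gap, of "\<bar>\<mu>\<bar> / \<gamma>"]])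
       (use A_le in auto)
  then have A_lim: "(\<lambda>k. A (y k)) \<longlonglongrightarrow> 0"
    using tendsto_real_sqrt[of "\<lambda>k. (N (A (y k)))\<^sup>2" 0] by (intro tendsto_N_0) simp
  obtain b where b: "b > 0" "\<And>x. norm x \<le> b * N x" by (rule le_N) blast
  obtain M where M: "\<And>k. N (y k) \<le> M"
    using convergent_imp_Bseq[of "\<lambda>k. N (y k)"] L by (auto simp: convergent_def Bseq_def)
  have "norm (y k) \<le> b * M" for k
    using b M[of k] by (meson mult_left_mono order_trans less_imp_le)
  then have "bounded (range y)" by (auto simp: bounded_iff)
  then obtain l \<sigma> where l: "strict_mono \<sigma>" "(y \<circ> \<sigma>) \<longlonglongrightarrow> l"
    using bounded_imp_convergent_subsequence by blast
  have lT: "l \<in> T"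
    by (rule closed_sequentially[OF closed_subspace[OF T] _ l(2)]) (simp add: y)
  have "(\<lambda>k. A ((y \<circ> \<sigma>) k)) \<longlonglongrightarrow> A l"
    using bounded_linear.tendsto[OF linear_conv_bounded_linear[THEN iffD1, OF A] l(2)] .
  then have Al: "A l = 0"
    using LIMSEQ_subseq_LIMSEQ[OF A_lim l(1)] LIMSEQ_unique by (fastforce simp: o_def)
  \<comment> \<open>The distances to \<open>l\<close> converge along the whole sequence, so their
    limit can be read off along the subsequence.\<close>
  obtain m where m: "(\<lambda>k. N (y k - l)) \<longlonglongrightarrow> m"
    using conv[OF lT Al] by (auto simp: convergent_def)
  have "(\<lambda>k. N ((y \<circ> \<sigma>) k - l)) \<longlonglongrightarrow> N (l - l)"
    by (intro tendsto_N tendsto_diff l(2) tendsto_const)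
  then have "m = 0"
    using LIMSEQ_subseq_LIMSEQ[OF m l(1)] LIMSEQ_unique linear_0[OF S(1)] by (fastforce simp: o_def)
  with m have "y \<longlonglongrightarrow> l" by (intro tendsto_N_0) simp
  then show ?thesis by (auto simp: convergent_def)
qed

end

section \<open>Nonlinear damped iterations with quadratic remainder\<close>

text \<open>The linearization of \<open>g\<close> at \<open>z\<close> is - A, and the two-point
  remainder allows orbits to be compared. \<open>F\<close> is a convex invariant set and need not be
  a neighbourhood of \<open>z\<close>.\<close>

locale damped_fixpoint_iteration = psd_operator S A T \<mu>
  for S A :: "'a::euclidean_space \<Rightarrow> 'a" and T :: "'a set" and \<mu> :: real +
  fixes g :: "'a \<Rightarrow> 'a" and F :: "'a set" and z :: 'a and c :: real
  assumes F: "convex F"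
    and z_in: "z \<in> F"
    and g_z: "g z = z"
    and g_in: "x \<in> F \<Longrightarrow> g x \<in> F"
    and diff_in: "x \<in> F \<Longrightarrow> y \<in> F \<Longrightarrow> x - y \<in> T"
    and c_pos: "c > 0"
    and remainder: "x \<in> F \<Longrightarrow> y \<in> F \<Longrightarrow>
      N (g x - g y + A (x - y)) \<le> c * (N (x - z) + N (y - z)) * N (x - y)"

begin

text \<open>Chosen independently of the step-size, so that one neighbourhood serves all admissible
  \<open>s\<close>. Within this radius c N (x - z) <= 1/4, and the exponent bounded in
  \<open>iter_pair_le\<close> becomes exactly 1 / (1 - s).\<close>

definition \<rho> where "\<rho> = 1 / (4 * c)"

lemma \<rho>_pos: "0 < \<rho>" using c_pos by (simp add: \<rho>_def)

end

locale damped_fixpoint_iteration_step = damped_fixpoint_iteration S A T \<mu> g F z c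
  for S A :: "'a::euclidean_space \<Rightarrow> 'a" and T :: "'a set" and \<mu> :: real
    and g :: "'a \<Rightarrow> 'a" and F :: "'a set" and z :: 'a and c :: real +
  fixes s :: real
  assumes s: "0 < s" "s < 1" "s * (2 + \<mu>) < 2"
begin

text \<open>The factorization (1 - s) I - s A = (1 - s)(I - \<kappa> A) turns the step-size
  condition into \<kappa> \<mu> < 2. \<open>q\<close> is a crude decay factor that makes the
  remainders summable; \<open>E\<close> bounds the product of the resulting corrections.\<close>

definition \<kappa> where "\<kappa> = s / (1 - s)"
definition E where "E = exp (1 / (1 - s))"
definition q where "q = 1 - s / 2"

lemma \<kappa>: "0 < \<kappa>" "\<kappa> * \<mu> < 2" "(1 - s) * \<kappa> = s"
  using s by (auto simp: \<kappa>_def field_simps)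

lemma E_pos: "0 < E" by (simp add: E_def)

lemma q: "0 < q" "q < 1" using s by (auto simp: q_def)

lemma N_0: "N 0 = 0" by (simp add: linear_0[OF S(1)])

lemma sum_q_le: "(\<Sum>j<k. q ^ j) \<le> 2 / s"
proof -
  have "(\<Sum>j<k. q ^ j) \<le> (\<Sum>j. q ^ j)"
    using q by (intro sum_le_suminf summable_geometric) auto
  also have "\<dots> = 2 / s" using q suminf_geometric[of q] by (simp add: q_def)
  finally show ?thesis .
qed

abbreviation iter :: "'a \<Rightarrow> nat \<Rightarrow> 'a" where "iter \<equiv> msa g s"

lemma iter_0: "iter x 0 = x" by (simp add: msa_def)

lemma iter_Suc: "iter x (Suc k) = msa_step g s (iter x k)" by (simp add: msa_def)

lemma step_in: "x \<in> F \<Longrightarrow> msa_step g s x \<in> F"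
  unfolding msa_step_def using F g_in s by (intro convexD) auto

lemma iter_in: "x \<in> F \<Longrightarrow> iter x k \<in> F"
  by (induction k) (simp_all add: iter_0 iter_Suc step_in)

lemma iter_z: "iter z k = z"
  by (induction k) (simp_all add: iter_0 iter_Suc msa_step_def g_z flip: scaleR_add_left)

lemma step_diff:
  "msa_step g s x - msa_step g s y =
     (1 - s) *\<^sub>R ((x - y) - \<kappa> *\<^sub>R A (x - y)) + s *\<^sub>R (g x - g y + A (x - y))"
  unfolding msa_step_def using \<kappa>(3) by (simp add: scaleR_diff_right scaleR_add_right)

lemma step_diff_le:
  assumes "x \<in> F" "y \<in> F"
  shows "N (msa_step g s x - msa_step g s y) \<le> (1 - s + s * c * (N (x - z) + N (y - z))) * N (x - y)"
proof -
  have "N (msa_step g s x - msa_step g s y) \<le>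
      (1 - s) * N ((x - y) - \<kappa> *\<^sub>R A (x - y)) + s * N (g x - g y + A (x - y))"
    unfolding step_diff using s N_add by (metis (no_types, lifting) N_scale abs_of_pos diff_gt_0_iff_gt)
  also have "\<dots> \<le> (1 - s) * N (x - y) + s * (c * (N (x - z) + N (y - z)) * N (x - y))"
    using s \<kappa> assms by (intro add_mono mult_left_mono damped_step_le diff_in remainder) auto
  finally show ?thesis by (simp add: algebra_simps)
qed

text \<open>A bootstrap: the factor \<open>q\<close> is not sharp, but it keeps the orbit within
  radius \<rho> and makes the distances to \<open>z\<close> summable, as the sharp estimate
  requires.\<close>

lemma iter_le:
  assumes "x \<in> F" "N (x - z) \<le> r" "r \<le> \<rho>"
  shows "N (iter x k - z) \<le> q ^ k * r"
proof (induction k)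
  case 0
  then show ?case using assms by (simp add: iter_0)
next
  case (Suc k)
  have r: "0 \<le> r" using assms(2) norm_ge_zero order_trans by blast
  have "q ^ k * r \<le> 1 * r" using q r by (intro mult_right_mono power_le_one) auto
  with Suc assms have "N (iter x k - z) \<le> \<rho>" by linarith
  then have "c * N (iter x k - z) \<le> 1 / 4"
    using c_pos by (simp add: \<rho>_def field_simps)
  then have *: "s * (c * N (iter x k - z)) \<le> s * (1 / 4)" using s by (intro mult_left_mono) auto
  have "N (iter x (Suc k) - z) = N (msa_step g s (iter x k) - msa_step g s z)"
    by (metis iter_Suc iter_z)
  also have "\<dots> \<le> (1 - s + s * c * N (iter x k - z)) * N (iter x k - z)"
    using step_diff_le[OF iter_in[OF assms(1), of k] z_in] N_0 by simp
  also have "\<dots> \<le> q * N (iter x k - z)"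
    using * s by (intro mult_right_mono) (auto simp: q_def algebra_simps)
  also have "\<dots> \<le> q * (q ^ k * r)" using Suc q by (intro mult_left_mono) auto
  finally show ?case by (simp add: mult.assoc)
qed

text \<open>Step \<open>k\<close> multiplies the distance by at most (1 - s)(1 + 2 \<kappa> c r
  q^k). The product of the corrections stays bounded by 1 + x <= exp x and the geometric series in
  \<open>q\<close>. The case y = z is decay at the sharp rate.\<close>

lemma iter_pair_le:
  assumes "x \<in> F" "N (x - z) \<le> r" "y \<in> F" "N (y - z) \<le> r" "r \<le> \<rho>"
  shows "N (iter x k - iter y k) \<le> E * (1 - s) ^ k * N (x - y)"
proof -
  have r: "0 \<le> r" using assms(2) norm_ge_zero order_trans by blast
  have "N (iter x k - iter y k) \<le> exp (\<kappa> * c * (2 * r) * (\<Sum>j<k. q ^ j)) * (1 - s) ^ k * N (x - y)"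
  proof (induction k)
    case 0
    then show ?case by (simp add: iter_0)
  next
    case (Suc k)
    have "N (iter x (Suc k) - iter y (Suc k)) \<le>
        (1 - s + s * c * (N (iter x k - z) + N (iter y k - z))) * N (iter x k - iter y k)"
      unfolding iter_Suc using assms by (intro step_diff_le iter_in)
    also have "\<dots> \<le> (1 - s + s * c * (q ^ k * r + q ^ k * r)) * N (iter x k - iter y k)"
      using assms s c_pos by (intro mult_right_mono mult_left_mono add_mono iter_le order_refl) auto
    also have "1 - s + s * c * (q ^ k * r + q ^ k * r) = 1 - s + ((1 - s) * \<kappa>) * c * (2 * r) * q ^ k"
      unfolding \<kappa>(3) by (simp add: algebra_simps)
    also have "\<dots> = (1 - s) * (1 + \<kappa> * c * (2 * r) * q ^ k)"
      by (simp add: algebra_simps)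
    also have "\<dots> * N (iter x k - iter y k) \<le>
        (1 - s) * exp (\<kappa> * c * (2 * r) * q ^ k) *
        (exp (\<kappa> * c * (2 * r) * (\<Sum>j<k. q ^ j)) * (1 - s) ^ k * N (x - y))"
      using s \<kappa> c_pos r q by (intro mult_mono Suc mult_left_mono exp_ge_add_one_self) auto
    finally show ?case by (simp add: exp_add algebra_simps)
  qed
  also have "\<dots> \<le> exp (1 / (1 - s)) * (1 - s) ^ k * N (x - y)"
  proof (intro mult_right_mono exp_le_cancel_iff[THEN iffD2])
    have "\<kappa> * c * (2 * r) * (\<Sum>j<k. q ^ j) \<le> \<kappa> * c * (2 * \<rho>) * (2 / s)"
      using assms r \<kappa> c_pos s q sum_q_le by (intro mult_mono) (auto intro: sum_nonneg)
    also have "\<dots> = 1 / (1 - s)" using s c_pos by (simp add: \<kappa>_def \<rho>_def field_simps)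
    finally show "\<kappa> * c * (2 * r) * (\<Sum>j<k. q ^ j) \<le> 1 / (1 - s)" .
  qed (use s in auto)
  finally show ?thesis by (simp add: E_def)
qed

section \<open>Rescaled errors and their limit\<close>

definition scaled :: "'a \<Rightarrow> 'a \<Rightarrow> nat \<Rightarrow> 'a" where
  "scaled x y k = (iter x k - iter y k) /\<^sub>R (1 - s) ^ k"

lemma scaled_0: "scaled x y 0 = x - y"
  by (simp add: scaled_def iter_0)

lemma scaled_in: "x \<in> F \<Longrightarrow> y \<in> F \<Longrightarrow> scaled x y k \<in> T"
  unfolding scaled_def by (intro subspace_scale T diff_in iter_in)

text \<open>Division by (1 - s)^k turns the step into I - \<kappa> A up to a summable error. The
  factor N (x - y) permits comparison of two limits; the factor \<open>r\<close> makes the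
  discrepancy small near \<open>z\<close>.\<close>

lemma scaled_step_le:
  assumes "x \<in> F" "N (x - z) \<le> r" "y \<in> F" "N (y - z) \<le> r" "r \<le> \<rho>"
  shows "N (scaled x y (Suc k) - (scaled x y k - \<kappa> *\<^sub>R A (scaled x y k))) \<le>
    2 * \<kappa> * c * r * E * N (x - y) * q ^ k"
proof -
  have r: "0 \<le> r" using assms(2) norm_ge_zero order_trans by blast
  define \<delta> where "\<delta> = iter x k - iter y k"
  define p where "p = (1 - s) ^ k"
  have p: "p > 0" using s by (simp add: p_def)
  have "scaled x y (Suc k) =
      (msa_step g s (iter x k) - msa_step g s (iter y k)) /\<^sub>R ((1 - s) * p)"
    by (simp add: scaled_def iter_Suc p_def)
  also have "\<dots> = (\<delta> - \<kappa> *\<^sub>R A \<delta>) /\<^sub>R p +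
      (s / ((1 - s) * p)) *\<^sub>R (g (iter x k) - g (iter y k) + A \<delta>)"
  proof -
    have "inverse ((1 - s) * p) * (1 - s) = inverse p" "inverse ((1 - s) * p) * s = s / ((1 - s) * p)"
      using s p by (simp_all add: divide_simps)
    then show ?thesis
      by (simp only: step_diff \<delta>_def[symmetric] scaleR_add_right scaleR_scaleR)
  qed
  also have "(\<delta> - \<kappa> *\<^sub>R A \<delta>) /\<^sub>R p = scaled x y k - \<kappa> *\<^sub>R A (scaled x y k)"
    by (simp add: scaled_def \<delta>_def p_def A_simps scaleR_diff_right mult.commute)
  finally have "scaled x y (Suc k) - (scaled x y k - \<kappa> *\<^sub>R A (scaled x y k)) =
      (\<kappa> / p) *\<^sub>R (g (iter x k) - g (iter y k) + A \<delta>)"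
    by (simp add: \<kappa>_def)
  then have "N (scaled x y (Suc k) - (scaled x y k - \<kappa> *\<^sub>R A (scaled x y k))) =
      \<kappa> / p * N (g (iter x k) - g (iter y k) + A \<delta>)"
    using \<kappa> p by (simp add: N_scale)
  also have "\<dots> \<le> \<kappa> / p * (c * (N (iter x k - z) + N (iter y k - z)) * N \<delta>)"
    unfolding \<delta>_def using \<kappa> p assms by (intro mult_left_mono remainder iter_in) auto
  also have "\<dots> \<le> \<kappa> / p * (c * (q ^ k * r + q ^ k * r) * (E * (1 - s) ^ k * N (x - y)))"
    unfolding \<delta>_def using \<kappa> p assms c_pos E_pos q r s
    by (intro mult_left_mono mult_mono add_mono iter_le iter_pair_le[of x r y]) auto
  also have "\<dots> = 2 * \<kappa> * c * r * E * N (x - y) * q ^ k"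
    using p by (simp add: p_def[symmetric] field_simps)
  finally show ?thesis .
qed

lemma scaled_convergent:
  assumes "x \<in> F" "N (x - z) \<le> \<rho>"
  shows "convergent (scaled x z)"
proof (rule perturbed_damped_iteration_convergent[OF _ \<kappa>(1,2)])
  show "scaled x z k \<in> T" for k using assms z_in by (intro scaled_in)
  show "N (scaled x z (Suc k) - (scaled x z k - \<kappa> *\<^sub>R A (scaled x z k))) \<le>
      2 * \<kappa> * c * \<rho> * E * N (x - z) * q ^ k" for k
    using assms z_in \<rho>_pos N_0 by (intro scaled_step_le) auto
  show "summable (\<lambda>k. 2 * \<kappa> * c * \<rho> * E * N (x - z) * q ^ k)"
    using q by (intro summable_mult summable_geometric) auto
qed

text \<open>A Koenigs-type linearizing map for the multiplier 1 - s. Its value carries meaning only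
  where \<open>scaled_convergent\<close> applies, in \<open>F\<close> near \<open>z\<close>.\<close>

definition rescaled_limit :: "'a \<Rightarrow> 'a" where
  "rescaled_limit x = lim (scaled x z)"

lemma scaled_tendsto:
  assumes "x \<in> F" "N (x - z) \<le> \<rho>"
  shows "scaled x z \<longlonglongrightarrow> rescaled_limit x"
  using scaled_convergent[OF assms] by (simp add: rescaled_limit_def convergent_LIMSEQ_iff)

lemma scaled_diff: "scaled x z k - scaled y z k = scaled x y k"
  by (simp add: scaled_def algebra_simps)

lemma scaled_pair_tendsto:
  assumes "x \<in> F" "N (x - z) \<le> \<rho>" "y \<in> F" "N (y - z) \<le> \<rho>"
  shows "scaled x y \<longlonglongrightarrow> rescaled_limit x - rescaled_limit y"
  using tendsto_diff[OF scaled_tendsto[OF assms(1,2)] scaled_tendsto[OF assms(3,4)]]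
  by (simp add: scaled_diff)

lemma rescaled_limit_lipschitz:
  assumes "x \<in> F" "N (x - z) \<le> \<rho>" "y \<in> F" "N (y - z) \<le> \<rho>"
  shows "N (rescaled_limit x - rescaled_limit y) \<le> E * N (x - y)"
proof (rule tendsto_upperbound[OF tendsto_N[OF scaled_pair_tendsto[OF assms]]])
  have "N (scaled x y k) \<le> E * N (x - y)" for k
  proof -
    have "N (scaled x y k) = N (iter x k - iter y k) / (1 - s) ^ k"
      using s by (simp add: scaled_def N_scale divide_inverse mult.commute)
    also have "\<dots> \<le> E * N (x - y)"
      using iter_pair_le[OF assms order_refl, of k] s by (simp add: field_simps)
    finally show ?thesis .
  qed
  then show "\<forall>\<^sub>F k in sequentially. N (scaled x y k) \<le> E * N (x - y)" by simp
qed simp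

text \<open>A displacement in the kernel of \<open>A\<close> is fixed by the linear step. So the
  deviation of the rescaled difference from x - y starts at 0, is never expanded, and collects only
  the summable errors, whose total is of order \<open>r\<close> relative to N (x - y).\<close>

lemma rescaled_limit_kernel:
  assumes "x \<in> F" "N (x - z) \<le> r" "y \<in> F" "N (y - z) \<le> r" "r \<le> \<rho>"
    and "A (x - y) = 0"
  shows "N (rescaled_limit x - rescaled_limit y - (x - y)) \<le> 4 * c * r * E / (1 - s) * N (x - y)"
proof -
  have r: "0 \<le> r" using assms(2) norm_ge_zero order_trans by blast
  define C where "C = 2 * \<kappa> * c * r * E * N (x - y)"
  have C: "C \<ge> 0" using \<kappa> c_pos r E_pos by (simp add: C_def)
  have "N (scaled x y k - (x - y)) \<le> C * (\<Sum>j<k. q ^ j)" for k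
  proof (induction k)
    case 0
    then show ?case using N_0 by (simp add: scaled_0)
  next
    case (Suc k)
    define w where "w = scaled x y k - (x - y)"
    have w: "w \<in> T" unfolding w_def using assms T by (intro subspace_diff scaled_in diff_in)
    have "scaled x y (Suc k) - (x - y) =
        (w - \<kappa> *\<^sub>R A w) + (scaled x y (Suc k) - (scaled x y k - \<kappa> *\<^sub>R A (scaled x y k)))"
      using assms(6) by (simp add: w_def A_simps)
    then have "N (scaled x y (Suc k) - (x - y)) \<le>
        N (w - \<kappa> *\<^sub>R A w) + N (scaled x y (Suc k) - (scaled x y k - \<kappa> *\<^sub>R A (scaled x y k)))"
      by (simp only: N_add)
    also have "\<dots> \<le> N w + C * q ^ k"
      unfolding C_def using \<kappa> w assms by (intro add_mono damped_step_le scaled_step_le) auto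
    also have "\<dots> \<le> C * (\<Sum>j<k. q ^ j) + C * q ^ k" using Suc by (simp add: w_def)
    finally show ?case by (simp add: algebra_simps)
  qed
  also have "C * (\<Sum>j<k. q ^ j) \<le> C * (2 / s)" for k
    using C sum_q_le by (intro mult_left_mono)
  also have "C * (2 / s) = 4 * c * r * E / (1 - s) * N (x - y)"
    using s by (simp add: C_def \<kappa>_def)
  finally have le: "N (scaled x y k - (x - y)) \<le> 4 * c * r * E / (1 - s) * N (x - y)" for k .
  have "(\<lambda>k. N (scaled x y k - (x - y))) \<longlonglongrightarrow> N (rescaled_limit x - rescaled_limit y - (x - y))"
    using assms by (intro tendsto_N tendsto_diff scaled_pair_tendsto tendsto_const) auto
  then show ?thesis
    by (rule tendsto_upperbound) (use le in auto)
qed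

lemma asymptotic_rate_iter:
  assumes "x \<in> F" "N (x - z) \<le> \<rho>" "rescaled_limit x \<noteq> 0"
  shows "asymptotic_rate (iter x) z (1 - s)"
proof -
  have n: "norm (iter x k - z) = (1 - s) ^ k * norm (scaled x z k)" for k
    using s by (simp add: scaled_def iter_z)
  have lim: "(\<lambda>k. norm (scaled x z k)) \<longlonglongrightarrow> norm (rescaled_limit x)"
    using assms by (intro tendsto_norm scaled_tendsto)
  have "(\<lambda>k. (1 - s) * (norm (scaled x z (Suc k)) / norm (scaled x z k))) \<longlonglongrightarrow>
      (1 - s) * (norm (rescaled_limit x) / norm (rescaled_limit x))"
    using assms(3) by (intro tendsto_mult tendsto_const tendsto_divide LIMSEQ_Suc[OF lim] lim) auto
  then show ?thesis
    using assms(3) s by (simp add: asymptotic_rate_def n)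
qed

lemma converges_faster_iter:
  assumes "x \<in> F" "N (x - z) \<le> \<rho>" "rescaled_limit x = 0"
  shows "converges_faster (iter x) z (1 - s)"
proof -
  have "norm (iter x k - z) / (1 - s) ^ k = norm (scaled x z k)" for k
    using s by (simp add: scaled_def iter_z divide_inverse mult.commute)
  then show ?thesis
    using tendsto_norm[OF scaled_tendsto[OF assms(1,2)]] assms(3)
    by (simp add: converges_faster_def)
qed

lemma iter_norm_le:
  obtains C where "\<And>x k. x \<in> F \<Longrightarrow> N (x - z) \<le> \<rho> \<Longrightarrow> norm (iter x k - z) \<le> C * (1 - s) ^ k * norm (x - z)"
proof -
  obtain b where b: "b > 0" "\<And>x. N x \<le> b * norm x" by (rule N_le) blast
  obtain B where B: "B > 0" "\<And>x. norm x \<le> B * N x" by (rule le_N) blast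
  have "norm (iter x k - z) \<le> (B * E * b) * (1 - s) ^ k * norm (x - z)"
    if "x \<in> F" "N (x - z) \<le> \<rho>" for x k
  proof -
    have "norm (iter x k - z) \<le> B * N (iter x k - z)" by (rule B)
    also have "\<dots> \<le> B * (E * (1 - s) ^ k * N (x - z))"
      using iter_pair_le[OF that z_in, of k] N_0 \<rho>_pos B by (intro mult_left_mono) (auto simp: iter_z)
    also have "\<dots> \<le> B * (E * (1 - s) ^ k * (b * norm (x - z)))"
      using B E_pos s b by (intro mult_left_mono) auto
    finally show ?thesis by (simp add: algebra_simps)
  qed
  then show ?thesis using that by blast
qed

text \<open>
  Moving the starting point by \<open>t *\<^sub>R u\<close> with \<open>A u = 0\<close> moves the rescaled limit by nearly \<open>t *\<^sub>R u\<close>, so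
  starting points whose rescaled limit vanishes can be perturbed away.
\<close>

lemma generic_asymptotic_rate:
  assumes u: "u \<noteq> 0" "A u = 0" and \<delta>0: "\<delta>0 > 0"
    and dir: "\<And>h. h \<in> F \<Longrightarrow> h \<in> ball z \<delta>0 \<Longrightarrow> \<exists>t0>0. \<forall>t. 0 < t \<and> t < t0 \<longrightarrow> h + t *\<^sub>R u \<in> F"
  shows "\<exists>\<delta>>0. \<exists>U. open U \<and> F \<inter> ball z \<delta> \<subseteq> closure (F \<inter> U) \<and>
    (\<forall>h0\<in>F \<inter> U \<inter> ball z \<delta>. asymptotic_rate (iter h0) z (1 - s))"
proof -
  obtain b where b: "b > 0" "\<And>x. N x \<le> b * norm x" by (rule N_le) blast
  obtain B where B: "B > 0" "\<And>x. norm x \<le> B * N x" by (rule le_N) blast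
  \<comment> \<open>With this radius the constant in \<open>rescaled_limit_kernel\<close> is at most
    1/2.\<close>
  define r where "r = min \<rho> ((1 - s) / (8 * c * E))"
  have r: "0 < r" "r \<le> \<rho>" "r \<le> (1 - s) / (8 * c * E)"
    using \<rho>_pos c_pos E_pos s by (auto simp: r_def)
  define \<delta> where "\<delta> = min \<delta>0 (r / b)"
  have \<delta>: "\<delta> > 0" using r b \<delta>0 by (simp add: \<delta>_def)
  define V where "V = F \<inter> ball z \<delta>"
  have V: "h \<in> F" "N (h - z) \<le> r" "h \<in> ball z \<delta>0" if "h \<in> V" for h
  proof -
    have "norm (h - z) < r / b" using that by (simp add: V_def \<delta>_def dist_norm norm_minus_commute)
    then have "b * norm (h - z) \<le> r" using b by (simp add: field_simps)
    then show "N (h - z) \<le> r" using b(2)[of "h - z"] by linarith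
  qed (use that in \<open>auto simp: V_def \<delta>_def\<close>)
  have "(B * E * b)-lipschitz_on V rescaled_limit"
  proof (rule lipschitz_onI)
    fix x y assume xy: "x \<in> V" "y \<in> V"
    have "norm (rescaled_limit x - rescaled_limit y) \<le> B * N (rescaled_limit x - rescaled_limit y)"
      by (rule B)
    also have "\<dots> \<le> B * (E * N (x - y))"
      using B V[OF xy(1)] V[OF xy(2)] r(2) by (intro mult_left_mono rescaled_limit_lipschitz) auto
    also have "\<dots> \<le> B * (E * (b * norm (x - y)))"
      using B E_pos b by (intro mult_left_mono) auto
    finally show "dist (rescaled_limit x) (rescaled_limit y) \<le> B * E * b * dist x y"
      by (simp add: dist_norm algebra_simps)
  qed (use B E_pos b in auto)
  then have "continuous_on V rescaled_limit" by (rule lipschitz_on_continuous_on)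
  \<comment> \<open>Continuity makes nonvanishing of the limit a relatively open condition on
    \<open>V\<close>; \<open>U\<close> is an open set that cuts it out.\<close>
  then have "openin (top_of_set V) (V \<inter> rescaled_limit -` (- {0}))"
    by (rule continuous_openin_preimage_gen) auto
  then obtain U where U: "open U" "V \<inter> rescaled_limit -` (- {0}) = V \<inter> U"
    unfolding openin_open by blast
  have "asymptotic_rate (iter h) z (1 - s)" if "h \<in> F \<inter> U \<inter> ball z \<delta>" for h
  proof -
    from that have "h \<in> V \<inter> U" by (simp add: V_def)
    then have h: "h \<in> V" "rescaled_limit h \<noteq> 0" using U(2) by blast+
    show ?thesis using V(1,2)[OF h(1)] h(2) r(2) by (intro asymptotic_rate_iter) auto
  qed
  moreover have "V \<subseteq> closure (F \<inter> U)"
  proof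
    fix h assume h: "h \<in> V"
    show "h \<in> closure (F \<inter> U)"
    proof (cases "rescaled_limit h = 0")
      case False
      then have "h \<in> V \<inter> U" unfolding U(2)[symmetric] using h by simp
      then have "h \<in> F \<inter> U" by (auto simp: V_def)
      then show ?thesis by (rule closure_subset[THEN subsetD])
    next
      case True
      obtain t0 where t0: "t0 > 0" "\<And>t. 0 < t \<Longrightarrow> t < t0 \<Longrightarrow> h + t *\<^sub>R u \<in> F"
        using dir V[OF h] by blast
      have "\<exists>y\<in>F \<inter> U. dist y h < e" if e: "e > 0" for e
      proof -
        have dz: "\<delta> - dist z h > 0" using h by (simp add: V_def)
        define m where "m = min e (\<delta> - dist z h)"
        \<comment> \<open>The bound t0 / 2 keeps the new point in \<open>F\<close>; the other one
          keeps it within \<open>e\<close> of \<open>h\<close> and inside the ball about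
          \<open>z\<close>.\<close>
        define t where "t = min (t0 / 2) (m / (2 * norm u))"
        have m: "m > 0" using e dz by (simp add: m_def)
        have t: "0 < t" "t < t0" "t \<le> m / (2 * norm u)"
          using t0 m u by (auto simp: t_def)
        define y where "y = h + t *\<^sub>R u"
        have "t * norm u \<le> m / 2" using t(3) u(1) by (simp add: field_simps)
        then have dy: "dist y h < m" using t m by (simp add: y_def dist_norm)
        have "dist z y \<le> dist z h + dist y h" using dist_triangle[of z y h] by (simp add: dist_commute)
        also have "\<dots> < \<delta>" using dy by (simp add: m_def)
        finally have yV: "y \<in> V" using t0(2)[OF t(1,2)] by (simp add: V_def y_def)
        have yh: "y - h = t *\<^sub>R u" by (simp add: y_def)
        have "N (rescaled_limit y - rescaled_limit h - (y - h)) \<le> 4 * c * r * E / (1 - s) * N (y - h)"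
          using V[OF yV] V[OF h] r(2) u yh by (intro rescaled_limit_kernel) (simp_all add: linear_scale[OF A])
        also have "\<dots> \<le> 1 / 2 * N (y - h)"
          using r(3) s c_pos E_pos by (intro mult_right_mono) (auto simp: field_simps)
        also have "\<dots> < N (y - h)"
          using u(1) t by (simp add: yh N_scale S_eq_0_iff)
        \<comment> \<open>If the limit vanished at \<open>y\<close> as it does at \<open>h\<close>,
          the left-hand side would equal N (y - h).\<close>
        finally have "rescaled_limit y \<noteq> 0"
          using True N_scale[of "-1" "y - h"] by auto
        then have "y \<in> V \<inter> U" unfolding U(2)[symmetric] using yV by simp
        then have "y \<in> F \<inter> U" by (auto simp: V_def)
        moreover have "dist y h < e" using dy by (simp add: m_def)
        ultimately show ?thesis by blast
      qed
      then show ?thesis by (simp add: closure_approachable)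
    qed
  qed
  ultimately show ?thesis using \<delta> U(1) by (auto simp: V_def intro!: exI[of _ \<delta>] exI[of _ U])
qed

end

text \<open>The radius depends only on \<rho> and a norm comparison constant, so it can be chosen
  before \<open>s\<close>; the constant \<open>C\<close> is chosen after it.\<close>

lemma (in damped_fixpoint_iteration) local_convergence:
  "\<exists>\<epsilon>>0. \<forall>s. 0 < s \<and> s < 1 \<and> s * (2 + \<mu>) < 2 \<longrightarrow>
     (\<forall>h0\<in>F \<inter> ball z \<epsilon>. converges_linearly (msa g s h0) z) \<and>
     (\<exists>C. \<forall>h0\<in>F \<inter> ball z \<epsilon>. \<forall>k. norm (msa g s h0 k - z) \<le> C * (1 - s) ^ k * norm (h0 - z)) \<and>
     (\<forall>h0\<in>F \<inter> ball z \<epsilon>.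
        asymptotic_rate (msa g s h0) z (1 - s) \<or> converges_faster (msa g s h0) z (1 - s))"
proof -
  obtain b where b: "b > 0" "\<And>x. N x \<le> b * norm x" by (rule N_le) blast
  define \<epsilon> where "\<epsilon> = \<rho> / b"
  have \<epsilon>: "\<epsilon> > 0" using b \<rho>_pos by (simp add: \<epsilon>_def)
  have near: "h \<in> F" "N (h - z) \<le> \<rho>" if "h \<in> F \<inter> ball z \<epsilon>" for h
  proof -
    have "norm (h - z) < \<rho> / b" using that by (simp add: \<epsilon>_def dist_norm norm_minus_commute)
    then have "b * norm (h - z) \<le> \<rho>" using b by (simp add: field_simps)
    then show "N (h - z) \<le> \<rho>" using b(2)[of "h - z"] by linarith
  qed (use that in auto)
  have "(\<forall>h0\<in>F \<inter> ball z \<epsilon>. converges_linearly (msa g s h0) z) \<and>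
     (\<exists>C. \<forall>h0\<in>F \<inter> ball z \<epsilon>. \<forall>k. norm (msa g s h0 k - z) \<le> C * (1 - s) ^ k * norm (h0 - z)) \<and>
     (\<forall>h0\<in>F \<inter> ball z \<epsilon>.
        asymptotic_rate (msa g s h0) z (1 - s) \<or> converges_faster (msa g s h0) z (1 - s))"
    if s: "0 < s" "s < 1" "s * (2 + \<mu>) < 2" for s :: real
  proof (intro conjI)
    interpret damped_fixpoint_iteration_step S A T \<mu> g F z c s
      by unfold_locales (use s in auto)
    obtain C where C: "\<And>x k. x \<in> F \<Longrightarrow> N (x - z) \<le> \<rho> \<Longrightarrow>
        norm (msa g s x k - z) \<le> C * (1 - s) ^ k * norm (x - z)"
      by (rule iter_norm_le) blast
    show "\<forall>h0\<in>F \<inter> ball z \<epsilon>. converges_linearly (msa g s h0) z"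
    proof
      fix h assume h: "h \<in> F \<inter> ball z \<epsilon>"
      have "norm (msa g s h k - z) \<le> (C * norm (h - z)) * (1 - s) ^ k" for k
        using C[OF near[OF h], of k] by (simp add: algebra_simps)
      then show "converges_linearly (msa g s h) z"
        using s unfolding converges_linearly_def
        by (intro exI[of _ "1 - s"] exI[of _ "C * norm (h - z)"]) auto
    qed
    show "\<exists>C. \<forall>h0\<in>F \<inter> ball z \<epsilon>. \<forall>k. norm (msa g s h0 k - z) \<le> C * (1 - s) ^ k * norm (h0 - z)"
      using C near by blast
    show "\<forall>h0\<in>F \<inter> ball z \<epsilon>.
        asymptotic_rate (msa g s h0) z (1 - s) \<or> converges_faster (msa g s h0) z (1 - s)"
      using asymptotic_rate_iter converges_faster_iter near by blast
  qed
  with \<epsilon> show ?thesis by blast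
qed

section \<open>Linearization with quadratic remainder\<close>

text \<open>Strict differentiability at \<open>x0\<close> relative to \<open>X\<close>, with linear
  modulus. As a two-point estimate on \<open>X\<close> it makes sense at boundary points with
  one-sided derivatives.\<close>

definition quadratically_linearized ::
    "('a::real_normed_vector \<Rightarrow> 'b::real_normed_vector) \<Rightarrow> ('a \<Rightarrow> 'b) \<Rightarrow> 'a \<Rightarrow> 'a set \<Rightarrow> bool" where
  "quadratically_linearized f f' x0 X \<longleftrightarrow> bounded_linear f' \<and>
     (\<exists>c\<ge>0. \<forall>x\<in>X. \<forall>y\<in>X. norm (f x - f y - f' (x - y)) \<le> c * (norm (x - x0) + norm (y - x0)) * norm (x - y))"

lemma quadratically_linearized_linear:
  "bounded_linear f \<Longrightarrow> quadratically_linearized f f x0 X"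
  unfolding quadratically_linearized_def
  by (auto intro!: exI[of _ 0] simp: bounded_linear.linear[THEN linear_diff])

text \<open>The mean value inequality is applied to f - f' x0 on a segment. Comparing the derivative
  with its value at \<open>x0\<close> is enough, because the segment stays in a ball about
  \<open>x0\<close>.\<close>

lemma quadratically_linearized_derivative:
  fixes f :: "'a::real_normed_vector \<Rightarrow> 'b::real_normed_vector"
  assumes X: "convex X" "x0 \<in> X"
    and f: "\<And>x. x \<in> X \<Longrightarrow> (f has_derivative f' x) (at x within X)"
    and lip: "\<And>x v. x \<in> X \<Longrightarrow> norm (f' x v - f' x0 v) \<le> K * norm (x - x0) * norm v"
  shows "quadratically_linearized f (f' x0) x0 X"
proof -
  have lin: "bounded_linear (f' x0)" using f[OF X(2)] by (rule has_derivative_bounded_linear)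
  have "norm (f x - f y - f' x0 (x - y)) \<le> \<bar>K\<bar> * (norm (x - x0) + norm (y - x0)) * norm (x - y)"
    if xy: "x \<in> X" "y \<in> X" for x y
  proof -
    define R where "R = norm (x - x0) + norm (y - x0)"
    have "closed_segment x y \<subseteq> cball x0 R"
      by (intro closed_segment_subset) (auto simp: R_def dist_norm norm_minus_commute)
    then have R: "norm (u - x0) \<le> R" if "u \<in> closed_segment x y" for u
      using that by (auto simp: dist_norm norm_minus_commute)
    have sub: "closed_segment x y \<subseteq> X" using X xy by (intro closed_segment_subset)
    have "norm ((f x - f' x0 x) - (f y - f' x0 y)) \<le> (\<bar>K\<bar> * R) * norm (x - y)"
    proof (rule differentiable_bound[of "closed_segment x y" "\<lambda>u. f u - f' x0 u" "\<lambda>u v. f' u v - f' x0 v"])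
      fix u assume u: "u \<in> closed_segment x y"
      show "((\<lambda>u. f u - f' x0 u) has_derivative (\<lambda>v. f' u v - f' x0 v)) (at u within closed_segment x y)"
        using has_derivative_subset[OF f sub] u sub
        by (intro has_derivative_diff bounded_linear_imp_has_derivative lin) auto
      show "onorm (\<lambda>v. f' u v - f' x0 v) \<le> \<bar>K\<bar> * R"
      proof (rule onorm_bound)
        show "0 \<le> \<bar>K\<bar> * R" by (simp add: R_def)
        fix v
        have "norm (f' u v - f' x0 v) \<le> K * norm (u - x0) * norm v" using lip u sub by blast
        also have "\<dots> \<le> \<bar>K\<bar> * R * norm v"
          using R[OF u] by (intro mult_right_mono mult_mono) auto
        finally show "norm (f' u v - f' x0 v) \<le> \<bar>K\<bar> * R * norm v" .
      qed
    qed auto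
    moreover have "f x - f y - f' x0 (x - y) = (f x - f' x0 x) - (f y - f' x0 y)"
      by (simp add: linear_diff[OF bounded_linear.linear[OF lin]])
    ultimately show ?thesis by (simp only: R_def)
  qed
  with lin show ?thesis unfolding quadratically_linearized_def
    by (intro conjI exI[of _ "\<bar>K\<bar>"]) auto
qed

lemma quadratically_linearized_lipschitz:
  assumes "quadratically_linearized f f' x0 X" "bounded X"
  obtains B where "B \<ge> 0" "\<And>x y. x \<in> X \<Longrightarrow> y \<in> X \<Longrightarrow> norm (f x - f y) \<le> B * norm (x - y)"
proof -
  obtain c where c: "c \<ge> 0" "\<And>x y. x \<in> X \<Longrightarrow> y \<in> X \<Longrightarrow>
      norm (f x - f y - f' (x - y)) \<le> c * (norm (x - x0) + norm (y - x0)) * norm (x - y)"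
    using assms(1) unfolding quadratically_linearized_def by blast
  obtain b where b: "b > 0" "\<And>x. norm (f' x) \<le> norm x * b"
    using bounded_linear.pos_bounded assms(1) unfolding quadratically_linearized_def by blast
  obtain R where R: "\<And>x. x \<in> X \<Longrightarrow> dist x0 x \<le> R" "R \<ge> 0"
    using bounded_any_center[of X x0] assms(2) by (metis dual_order.trans linorder_le_cases)
  have "norm (f x - f y) \<le> (c * (R + R) + b) * norm (x - y)" if "x \<in> X" "y \<in> X" for x y
  proof -
    have "norm (f x - f y) \<le> norm (f x - f y - f' (x - y)) + norm (f' (x - y))"
      using norm_triangle_ineq[of "f x - f y - f' (x - y)" "f' (x - y)"] by simp
    also have "\<dots> \<le> c * (norm (x - x0) + norm (y - x0)) * norm (x - y) + norm (x - y) * b"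
      using c(2) b that by (intro add_mono) auto
    also have "\<dots> \<le> c * (R + R) * norm (x - y) + norm (x - y) * b"
      using R(1) that c
      by (intro add_right_mono mult_right_mono mult_left_mono add_mono) (auto simp: dist_norm norm_minus_commute[of x0])
    finally show ?thesis by (simp add: algebra_simps)
  qed
  moreover have "c * (R + R) + b \<ge> 0" using c b R by simp
  ultimately show ?thesis using that by blast
qed

text \<open>The error is the remainder of \<open>g\<close> plus the image under g' of the remainder
  of \<open>f\<close>. Boundedness of \<open>X\<close> makes \<open>f\<close> Lipschitz there, which
  turns distances of image points into distances in \<open>X\<close>.\<close>

lemma quadratically_linearized_compose:
  assumes f: "quadratically_linearized f f' x0 X" and X: "bounded X" "x0 \<in> X"
    and g: "quadratically_linearized g g' (f x0) (f ` X)"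
  shows "quadratically_linearized (\<lambda>x. g (f x)) (\<lambda>x. g' (f' x)) x0 X"
proof -
  obtain c where c: "c \<ge> 0" "\<And>x y. x \<in> X \<Longrightarrow> y \<in> X \<Longrightarrow>
      norm (f x - f y - f' (x - y)) \<le> c * (norm (x - x0) + norm (y - x0)) * norm (x - y)"
    using f unfolding quadratically_linearized_def by blast
  obtain e where e: "e \<ge> 0" "\<And>x y. x \<in> X \<Longrightarrow> y \<in> X \<Longrightarrow> norm (g (f x) - g (f y) - g' (f x - f y))
      \<le> e * (norm (f x - f x0) + norm (f y - f x0)) * norm (f x - f y)"
    using g unfolding quadratically_linearized_def by blast
  have lin: "bounded_linear f'" "bounded_linear g'"
    using f g by (auto simp: quadratically_linearized_def)
  obtain b where b: "b > 0" "\<And>x. norm (g' x) \<le> norm x * b"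
    using bounded_linear.pos_bounded lin(2) by blast
  obtain B where B: "B \<ge> 0" "\<And>x y. x \<in> X \<Longrightarrow> y \<in> X \<Longrightarrow> norm (f x - f y) \<le> B * norm (x - y)"
    using quadratically_linearized_lipschitz[OF f X(1)] by blast
  have "norm (g (f x) - g (f y) - g' (f' (x - y))) \<le>
      (e * B * B + c * b) * (norm (x - x0) + norm (y - x0)) * norm (x - y)" if xy: "x \<in> X" "y \<in> X" for x y
  proof -
    have "g (f x) - g (f y) - g' (f' (x - y)) =
        (g (f x) - g (f y) - g' (f x - f y)) + g' (f x - f y - f' (x - y))"
      by (simp add: linear_diff[OF bounded_linear.linear[OF lin(2)]])
    then have "norm (g (f x) - g (f y) - g' (f' (x - y))) \<le>
        norm (g (f x) - g (f y) - g' (f x - f y)) + norm (g' (f x - f y - f' (x - y)))"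
      by (simp only: norm_triangle_ineq)
    also have "\<dots> \<le> e * (norm (f x - f x0) + norm (f y - f x0)) * norm (f x - f y)
        + norm (f x - f y - f' (x - y)) * b"
      using e(2) b xy by (intro add_mono) auto
    also have "\<dots> \<le> e * (B * norm (x - x0) + B * norm (y - x0)) * (B * norm (x - y))
        + (c * (norm (x - x0) + norm (y - x0)) * norm (x - y)) * b"
      using B c e b xy X(2) by (intro add_mono mult_mono mult_nonneg_nonneg order_refl) auto
    finally show ?thesis by (simp add: algebra_simps)
  qed
  moreover have "e * B * B + c * b \<ge> 0" using e B c b by simp
  moreover have "bounded_linear (\<lambda>x. g' (f' x))" using lin by (rule bounded_linear_compose[rotated])
  ultimately show ?thesis unfolding quadratically_linearized_def by blast
qed

lemma quadratically_linearized_vec: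
  fixes f :: "'a::real_normed_vector \<Rightarrow> real^'n"
  assumes "\<And>i. quadratically_linearized (\<lambda>x. f x $ i) (\<lambda>x. f' x $ i) x0 X"
  shows "quadratically_linearized f f' x0 X"
proof -
  have "\<exists>c. \<forall>i. c i \<ge> 0 \<and> (\<forall>x\<in>X. \<forall>y\<in>X. \<bar>f x $ i - f y $ i - f' (x - y) $ i\<bar>
      \<le> c i * (norm (x - x0) + norm (y - x0)) * norm (x - y))"
    using assms unfolding quadratically_linearized_def real_norm_def by metis
  then obtain c where c: "\<And>i. c i \<ge> 0" "\<And>i x y. x \<in> X \<Longrightarrow> y \<in> X \<Longrightarrow>
      \<bar>f x $ i - f y $ i - f' (x - y) $ i\<bar> \<le> c i * (norm (x - x0) + norm (y - x0)) * norm (x - y)"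
    by blast
  have "norm (f x - f y - f' (x - y)) \<le> (\<Sum>i\<in>UNIV. c i) * (norm (x - x0) + norm (y - x0)) * norm (x - y)"
    if "x \<in> X" "y \<in> X" for x y
  proof -
    have "norm (f x - f y - f' (x - y)) \<le> (\<Sum>i\<in>UNIV. \<bar>(f x - f y - f' (x - y)) $ i\<bar>)"
      by (rule norm_le_l1_cart)
    also have "\<dots> \<le> (\<Sum>i\<in>UNIV. c i * (norm (x - x0) + norm (y - x0)) * norm (x - y))"
      using c(2) that by (intro sum_mono) simp
    finally show ?thesis by (simp add: sum_distrib_right)
  qed
  moreover have "bounded_linear f'"
    using assms bounded_linear_componentwise_iff[of f']
    by (auto simp: quadratically_linearized_def Basis_vec_def inner_axis)
  ultimately show ?thesis
    unfolding quadratically_linearized_def using c(1) by (meson sum_nonneg)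
qed

section \<open>The logit choice map\<close>

text \<open>The softmax derivative in centred form. It depends on the costs through the
  probabilities alone, so the regularity of \<open>logit_choice\<close> passes on to its own
  derivative.\<close>

definition logit_choice_deriv :: "real \<Rightarrow> ('n::finite \<Rightarrow> 'o) \<Rightarrow> real^'n \<Rightarrow> real^'n \<Rightarrow> real^'n" where
  "logit_choice_deriv \<theta> od p v =
     (\<chi> i. - \<theta> * p $ i * (v $ i - (\<Sum>j | od j = od i. p $ j * v $ j)))"

lemma logit_denominator_pos: "(\<Sum>j | od j = od (i::'n::finite). exp (- \<theta> * c $ j)) > (0::real)"
  by (rule sum_pos) auto

lemma logit_choice_pos: "logit_choice \<theta> od c $ i > 0"
  using logit_denominator_pos[where od=od and i=i] by (simp add: logit_choice_def)

lemma sum_logit_choice: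
  fixes od :: "'n::finite \<Rightarrow> 'o"
  assumes "surj od"
  shows "(\<Sum>i | od i = w. logit_choice \<theta> od c $ i) = 1"
proof -
  obtain i where i: "w = od i" using assms by auto
  have "(\<Sum>j | od j = w. logit_choice \<theta> od c $ j) =
      (\<Sum>j | od j = w. exp (- \<theta> * c $ j) / (\<Sum>j | od j = w. exp (- \<theta> * c $ j)))"
    by (rule sum.cong) (auto simp: logit_choice_def)
  also have "\<dots> = 1"
    using logit_denominator_pos[of \<theta> c od i] i by (simp flip: sum_divide_distrib)
  finally show ?thesis .
qed

lemma logit_choice_le_1:
  fixes od :: "'n::finite \<Rightarrow> 'o"
  assumes "surj od"
  shows "logit_choice \<theta> od c $ i \<le> 1"
proof -
  have "logit_choice \<theta> od c $ i \<le> (\<Sum>j | od j = od i. logit_choice \<theta> od c $ j)"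
    by (rule member_le_sum) (auto intro: less_imp_le logit_choice_pos)
  then show ?thesis using sum_logit_choice[OF assms] by simp
qed

lemma logit_choice_has_derivative_nth:
  "((\<lambda>c. logit_choice \<theta> od c $ i) has_derivative
     (\<lambda>v. logit_choice_deriv \<theta> od (logit_choice \<theta> od c) v $ i)) (at c)"
proof -
  define Z where "Z = (\<Sum>j | od j = od i. exp (- \<theta> * c $ j))"
  have Z: "Z > 0" unfolding Z_def by (rule logit_denominator_pos)
  have nth: "((\<lambda>c. c $ j) has_derivative (\<lambda>v. v $ j)) (at c)" for j
    by (intro bounded_linear_imp_has_derivative bounded_linear_vec_nth)
  have exp_nth: "((\<lambda>c. exp (- \<theta> * c $ j)) has_derivative (\<lambda>v. exp (- \<theta> * c $ j) * (- \<theta> * v $ j))) (at c)" for j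
    by (auto intro!: derivative_eq_intros nth)
  have "((\<lambda>c. exp (- \<theta> * c $ i) / (\<Sum>j | od j = od i. exp (- \<theta> * c $ j))) has_derivative
      (\<lambda>v. - exp (- \<theta> * c $ i) * (inverse Z * (\<Sum>j | od j = od i. exp (- \<theta> * c $ j) * (- \<theta> * v $ j)) * inverse Z)
        + exp (- \<theta> * c $ i) * (- \<theta> * v $ i) / Z)) (at c)"
    unfolding Z_def using logit_denominator_pos[of \<theta> c od i]
    by (intro has_derivative_divide has_derivative_sum exp_nth) auto
  moreover have "- exp (- \<theta> * c $ i) * (inverse Z * (\<Sum>j | od j = od i. exp (- \<theta> * c $ j) * (- \<theta> * v $ j)) * inverse Z)
        + exp (- \<theta> * c $ i) * (- \<theta> * v $ i) / Z = logit_choice_deriv \<theta> od (logit_choice \<theta> od c) v $ i" for v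
  proof -
    define Y where "Y = (\<Sum>j | od j = od i. exp (- \<theta> * c $ j) * v $ j)"
    have p: "logit_choice \<theta> od c $ i = exp (- \<theta> * c $ i) / Z"
      by (simp add: logit_choice_def Z_def)
    have "(\<Sum>j | od j = od i. logit_choice \<theta> od c $ j * v $ j) = Y / Z"
      unfolding Y_def sum_divide_distrib by (rule sum.cong) (auto simp: logit_choice_def Z_def)
    moreover have "(\<Sum>j | od j = od i. exp (- \<theta> * c $ j) * (- \<theta> * v $ j)) = - \<theta> * Y"
      unfolding Y_def sum_distrib_left by (rule sum.cong) auto
    ultimately show ?thesis
      unfolding logit_choice_deriv_def vec_lambda_beta p
      using Z by (simp add: divide_inverse algebra_simps)
  qed
  ultimately show ?thesis by (simp add: logit_choice_def)
qed

lemma logit_choice_has_derivative: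
  "(logit_choice \<theta> od has_derivative logit_choice_deriv \<theta> od (logit_choice \<theta> od c)) (at c)"
  using logit_choice_has_derivative_nth
  by (subst has_derivative_componentwise_within) (auto simp: Basis_vec_def inner_axis)

lemma weighted_average_le:
  fixes p v :: "real^'n::finite"
  assumes "\<And>j. 0 \<le> p $ j" "(\<Sum>j\<in>J. p $ j) = 1"
  shows "\<bar>\<Sum>j\<in>J. p $ j * v $ j\<bar> \<le> norm v"
proof -
  have "\<bar>\<Sum>j\<in>J. p $ j * v $ j\<bar> \<le> (\<Sum>j\<in>J. p $ j * norm v)"
    using assms(1) component_le_norm_cart[of v]
    by (intro order_trans[OF sum_abs] sum_mono) (auto simp: abs_mult intro!: mult_left_mono)
  then show ?thesis using assms(2) by (simp flip: sum_distrib_right)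
qed

text \<open>Probabilities lie in [0, 1], so each component has derivative of norm at most 2
  \<theta>. Hence the probabilities are Lipschitz, and then so is the derivative, a polynomial in
  them. The estimate holds on the whole space and restricts to \<open>X\<close>.\<close>

lemma quadratically_linearized_logit_choice:
  fixes od :: "'n::finite \<Rightarrow> 'o"
  assumes od: "surj od" and \<theta>: "\<theta> > 0"
  shows "quadratically_linearized (logit_choice \<theta> od)
     (logit_choice_deriv \<theta> od (logit_choice \<theta> od c0)) c0 X"
proof -
  define P where "P = logit_choice \<theta> od"
  have P: "0 \<le> P c $ i" "P c $ i \<le> 1" "(\<Sum>j | od j = od i. P c $ j) = 1" for c i
    unfolding P_def using od by (simp_all add: logit_choice_pos less_imp_le logit_choice_le_1 sum_logit_choice)
  define m where "m i p v = v $ i - (\<Sum>j | od j = od i. p $ j * v $ j)" for i and p v :: "real^'n"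
  have m: "\<bar>m i (P c) v\<bar> \<le> 2 * norm v" for i c v
    using weighted_average_le[of "P c" "{j. od j = od i}" v] P component_le_norm_cart[of v i]
    by (simp add: m_def)
  have deriv: "((\<lambda>c. P c $ i) has_derivative (\<lambda>v. - \<theta> * P c $ i * m i (P c) v)) (at c)" for c i
    using logit_choice_has_derivative_nth[of \<theta> od i c] by (simp add: P_def logit_choice_deriv_def m_def)
  have lip: "\<bar>P c $ i - P c' $ i\<bar> \<le> 2 * \<theta> * norm (c - c')" for c c' i
    unfolding real_norm_def[symmetric]
  proof (rule differentiable_bound[OF convex_UNIV deriv])
    fix c :: "real^'n"
    show "onorm (\<lambda>v. - \<theta> * P c $ i * m i (P c) v) \<le> 2 * \<theta>"
    proof (rule onorm_le)
      fix v
      have "norm (- \<theta> * P c $ i * m i (P c) v) = \<theta> * P c $ i * \<bar>m i (P c) v\<bar>"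
        using P \<theta> by (simp add: abs_mult)
      also have "\<dots> \<le> \<theta> * 1 * (2 * norm v)" using \<theta> P m by (intro mult_mono) auto
      finally show "norm (- \<theta> * P c $ i * m i (P c) v) \<le> 2 * \<theta> * norm v" by simp
    qed
  qed auto
  define K where "K = \<theta> * (2 * \<theta> * 2 + real CARD('n) * (2 * \<theta>))"
  have mdiff: "\<bar>m i (P c) v - m i (P c0) v\<bar> \<le> real CARD('n) * (2 * \<theta>) * norm (c - c0) * norm v" for i c v
  proof -
    have "m i (P c) v - m i (P c0) v = - (\<Sum>j | od j = od i. (P c $ j - P c0 $ j) * v $ j)"
      by (simp add: m_def sum_subtractf algebra_simps)
    then have "\<bar>m i (P c) v - m i (P c0) v\<bar> \<le> (\<Sum>j | od j = od i. \<bar>P c $ j - P c0 $ j\<bar> * \<bar>v $ j\<bar>)"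
      using sum_abs[of "\<lambda>j. (P c $ j - P c0 $ j) * v $ j" "{j. od j = od i}"] by (simp add: abs_mult)
    also have "\<dots> \<le> (\<Sum>j | od j = od i. (2 * \<theta> * norm (c - c0)) * norm v)"
      using lip \<theta> by (intro sum_mono mult_mono component_le_norm_cart) auto
    also have "\<dots> \<le> (\<Sum>j::'n\<in>UNIV. (2 * \<theta> * norm (c - c0)) * norm v)"
      using \<theta> by (intro sum_mono2) auto
    finally show ?thesis by simp
  qed
  have "quadratically_linearized (\<lambda>c. P c $ i) (\<lambda>v. - \<theta> * P c0 $ i * m i (P c0) v) c0 UNIV" for i
  proof (rule quadratically_linearized_derivative)
    fix c v :: "real^'n"
    have "- \<theta> * P c $ i * m i (P c) v - - \<theta> * P c0 $ i * m i (P c0) v =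
        - \<theta> * ((P c $ i - P c0 $ i) * m i (P c) v + P c0 $ i * (m i (P c) v - m i (P c0) v))"
      by (simp add: algebra_simps)
    then have "norm (- \<theta> * P c $ i * m i (P c) v - - \<theta> * P c0 $ i * m i (P c0) v) =
        \<theta> * \<bar>(P c $ i - P c0 $ i) * m i (P c) v + P c0 $ i * (m i (P c) v - m i (P c0) v)\<bar>"
      using \<theta> by (simp add: abs_mult)
    also have "\<dots> \<le> \<theta> * (\<bar>P c $ i - P c0 $ i\<bar> * \<bar>m i (P c) v\<bar> + P c0 $ i * \<bar>m i (P c) v - m i (P c0) v\<bar>)"
      using \<theta> P(1) by (intro mult_left_mono order_trans[OF abs_triangle_ineq]) (auto simp: abs_mult)
    also have "\<dots> \<le> \<theta> * ((2 * \<theta> * norm (c - c0)) * (2 * norm v)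
        + 1 * (real CARD('n) * (2 * \<theta>) * norm (c - c0) * norm v))"
      using \<theta> P lip m mdiff by (intro mult_left_mono add_mono mult_mono) auto
    finally show "norm (- \<theta> * P c $ i * m i (P c) v - - \<theta> * P c0 $ i * m i (P c0) v)
        \<le> K * norm (c - c0) * norm v"
      by (simp add: K_def algebra_simps)
  qed (use deriv in auto)
  then have "quadratically_linearized P (logit_choice_deriv \<theta> od (P c0)) c0 UNIV"
    by (intro quadratically_linearized_vec) (simp add: logit_choice_deriv_def m_def)
  then show ?thesis
    unfolding P_def quadratically_linearized_def by blast
qed

section \<open>The logit map at the equilibrium\<close>

lemma jacobian_mult:
  fixes f :: "real^'a \<Rightarrow> real^'b"
  assumes "(f has_derivative f') (at x)"
  shows "jacobian f (at x) *v v = f' v"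
  using assms jacobian_works[of f "at x"] has_derivative_unique differentiableI by metis

lemma quadratically_linearized_cong:
  assumes "quadratically_linearized f f' x0 X" "\<And>x. x \<in> X \<Longrightarrow> f x = g x" "\<And>v. f' v = g' v"
  shows "quadratically_linearized g g' x0 X"
proof -
  have "f' = g'" using assms(3) by blast
  then show ?thesis using assms(1,2) by (simp add: quadratically_linearized_def)
qed

context logit_network
begin

abbreviation D :: "real^'n^'l" where "D \<equiv> incidence route"
abbreviation F :: "(real^'n) set" where "F \<equiv> feasible od d"
abbreviation C :: "real^'n \<Rightarrow> real^'n" where "C \<equiv> path_costs D \<tau>"
abbreviation J :: "real^'n \<Rightarrow> real^'n^'n" where "J \<equiv> path_costs_jacobian D \<tau>'"
abbreviation L :: "real^'n \<Rightarrow> real^'n" where "L \<equiv> logit_map \<theta> od D \<tau>"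

lemma feasible_nonneg: "h \<in> F \<Longrightarrow> 0 \<le> h $ i"
  and feasible_sum: "h \<in> F \<Longrightarrow> (\<Sum>i | od i = w. h $ i) = d w"
  by (auto simp: feasible_def)

lemma feasible_le: "h \<in> F \<Longrightarrow> h $ i \<le> d (od i)"
  using feasible_nonneg feasible_sum[of h "od i"]
    member_le_sum[of i "{j. od j = od i}" "\<lambda>j. h $ j"] by simp

lemma convex_feasible: "convex F"
  unfolding convex_def feasible_def
  by (auto simp: sum.distrib simp flip: sum_distrib_left distrib_right)

lemma bounded_feasible: "bounded F"
proof -
  have "norm h \<le> (\<Sum>i\<in>UNIV. d (od i))" if "h \<in> F" for h
  proof -
    have "norm h \<le> (\<Sum>i\<in>UNIV. \<bar>h $ i\<bar>)" by (rule norm_le_l1_cart)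
    also have "\<dots> \<le> (\<Sum>i\<in>UNIV. d (od i))"
      using that feasible_nonneg feasible_le by (intro sum_mono) simp
    finally show ?thesis .
  qed
  then show ?thesis by (auto simp: bounded_iff)
qed

lemma link_flow_nonneg: "h \<in> F \<Longrightarrow> 0 \<le> (D *v h) $ l"
  unfolding matrix_vector_mult_def incidence_def using feasible_nonneg by (auto intro!: sum_nonneg)

text \<open>Difference quotients from the right also cover flow 0, where the derivative is
  one-sided.\<close>

lemma cost_deriv_nonneg:
  assumes "0 \<le> a"
  shows "0 \<le> \<tau>' l a"
proof -
  have "(\<tau> l has_real_derivative \<tau>' l a) (at a within {a..})"
    by (rule DERIV_subset[OF cost_deriv]) (use assms in auto)
  then have "((\<lambda>y. (\<tau> l y - \<tau> l a) / (y - a)) \<longlongrightarrow> \<tau>' l a) (at_right a)"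
    by (simp add: has_field_derivative_iff at_within_Ici_at_right)
  moreover have "\<forall>\<^sub>F y in at_right a. 0 \<le> (\<tau> l y - \<tau> l a) / (y - a)"
  proof (rule eventually_at_right_less[THEN eventually_mono])
    fix y assume "a < y"
    then show "0 \<le> (\<tau> l y - \<tau> l a) / (y - a)"
      using assms mono_onD[OF cost_mono[of l], of a y] by simp
  qed
  ultimately show ?thesis
    by (rule tendsto_lowerbound) simp
qed

lemma path_costs_jacobian_mult:
  "J h *v v = transpose D *v (\<chi> l. \<tau>' l ((D *v h) $ l) * (D *v v) $ l)"
proof -
  have "(\<chi> l m. if l = m then \<tau>' l ((D *v h) $ l) else 0) *v w =
      (\<chi> l. \<tau>' l ((D *v h) $ l) * w $ l)" for w
    by (simp add: vec_eq_iff matrix_vector_mult_def if_distrib[of "\<lambda>x. x * _"] cong: if_cong)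
  then show ?thesis
    by (simp add: path_costs_jacobian_def matrix_vector_mul_assoc[symmetric])
qed

text \<open>Over links the form is diagonal, so symmetry and, for nonnegative link derivatives,
  semidefiniteness can be read off.\<close>

lemma inner_path_costs_jacobian:
  "x \<bullet> (J h *v y) = (\<Sum>l\<in>UNIV. \<tau>' l ((D *v h) $ l) * (D *v x) $ l * (D *v y) $ l)"
proof -
  have "x \<bullet> (J h *v y) = ((\<chi> l. \<tau>' l ((D *v h) $ l) * (D *v y) $ l) v* D) \<bullet> x"
    unfolding path_costs_jacobian_mult transpose_matrix_vector by (rule inner_commute)
  also have "\<dots> = (\<chi> l. \<tau>' l ((D *v h) $ l) * (D *v y) $ l) \<bullet> (D *v x)"
    by (rule dot_lmul_matrix)
  also have "\<dots> = (\<Sum>l\<in>UNIV. \<tau>' l ((D *v h) $ l) * (D *v x) $ l * (D *v y) $ l)"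
    unfolding inner_vec_def by (rule sum.cong) simp_all
  finally show ?thesis .
qed

lemma path_costs_jacobian_sym: "x \<bullet> (J h *v y) = (J h *v x) \<bullet> y"
  unfolding inner_path_costs_jacobian inner_commute[of "J h *v x"]
  by (simp add: mult.assoc mult.commute mult.left_commute)

lemma path_costs_jacobian_nonneg: "h \<in> F \<Longrightarrow> 0 \<le> x \<bullet> (J h *v x)"
  unfolding inner_path_costs_jacobian
  by (intro sum_nonneg) (simp add: mult.assoc cost_deriv_nonneg link_flow_nonneg)

lemma logit_map_in: "h \<in> F \<Longrightarrow> L h \<in> F"
proof -
  assume h: "h \<in> F"
  have "L h $ i = d (od i) * logit_choice \<theta> od (C h) $ i" for i
    using feasible_sum[OF h, of "od i"] by (simp add: logit_map_def demand_split_def)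
  then show ?thesis
    using demand_nonneg logit_choice_pos[of \<theta> od "C h"] sum_logit_choice[OF paths_nonempty, of \<theta> "C h"]
    by (auto simp: feasible_def less_imp_le simp flip: sum_distrib_left)
qed

text \<open>The feasible flows of one link form a convex subset of [0, \<infinity>), which is where
  the Lipschitz bound on the cost derivative is available. The other maps are linear.\<close>

lemma quadratically_linearized_path_costs:
  assumes hh: "hh \<in> F"
  shows "quadratically_linearized C (\<lambda>v. J hh *v v) hh F"
proof -
  have flow: "bounded_linear (\<lambda>h. (D *v h) $ l)" for l
    by (intro bounded_linear_compose[OF bounded_linear_vec_nth] matrix_vector_mul_bounded_linear)
  have link: "quadratically_linearized (\<lambda>h. \<tau> l ((D *v h) $ l))
      (\<lambda>v. \<tau>' l ((D *v hh) $ l) * (D *v v) $ l) hh F" for l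
  proof (rule quadratically_linearized_compose[where g="\<tau> l",
        OF quadratically_linearized_linear[OF flow] bounded_feasible hh])
    define I where "I = (\<lambda>h. (D *v h) $ l) ` F"
    define a0 where "a0 = (D *v hh) $ l"
    obtain K where K: "K-lipschitz_on I (\<tau>' l)"
      using cost_deriv_lipschitz[of l] by (auto simp: I_def)
    have I: "convex I" "a0 \<in> I"
      using hh convex_linear_image[OF bounded_linear.linear[OF flow] convex_feasible]
      by (auto simp: I_def a0_def)
    have "quadratically_linearized (\<tau> l) (\<lambda>v. \<tau>' l a0 * v) a0 I"
    proof (rule quadratically_linearized_derivative[where f'="\<lambda>a v. \<tau>' l a * v", OF I])
      fix a assume a: "a \<in> I"
      then have "0 \<le> a" using link_flow_nonneg by (auto simp: I_def)
      have "I \<subseteq> {0..}" using link_flow_nonneg by (auto simp: I_def)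
      then show "(\<tau> l has_derivative (\<lambda>v. \<tau>' l a * v)) (at a within I)"
        using DERIV_subset[OF cost_deriv[OF \<open>0 \<le> a\<close>]] by (simp add: has_field_derivative_def)
      fix v
      have "norm (\<tau>' l a * v - \<tau>' l a0 * v) = dist (\<tau>' l a) (\<tau>' l a0) * \<bar>v\<bar>"
        by (simp add: dist_real_def abs_mult flip: left_diff_distrib)
      also have "\<dots> \<le> K * dist a a0 * \<bar>v\<bar>"
        by (intro mult_right_mono lipschitz_onD[OF K a I(2)]) simp
      finally show "norm (\<tau>' l a * v - \<tau>' l a0 * v) \<le> K * norm (a - a0) * norm v"
        by (simp add: dist_real_def)
    qed
    then show "quadratically_linearized (\<tau> l) ((*) (\<tau>' l ((D *v hh) $ l))) ((D *v hh) $ l) ((\<lambda>h. (D *v h) $ l) ` F)"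
      by (simp add: I_def a0_def)
  qed
  have "quadratically_linearized (\<lambda>h. link_costs \<tau> (D *v h))
      (\<lambda>v. \<chi> l. \<tau>' l ((D *v hh) $ l) * (D *v v) $ l) hh F"
    using link by (intro quadratically_linearized_vec) (simp add: link_costs_def)
  from quadratically_linearized_compose[OF this bounded_feasible hh
      quadratically_linearized_linear[OF matrix_vector_mul_bounded_linear[of "transpose D"]]]
  show ?thesis
    by (rule quadratically_linearized_cong) (simp_all add: path_costs_def path_costs_jacobian_mult)
qed

end

section \<open>Linearization at the equilibrium\<close>

locale logit_equilibrium = logit_network G origin destination od route d \<tau> \<tau>' \<tau>'' \<theta>
  for G :: "('v, 'l::finite) pre_digraph"
    and origin destination :: "'o::finite \<Rightarrow> 'v"
    and od :: "'n::finite \<Rightarrow> 'o"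
    and route :: "'n \<Rightarrow> 'l list"
    and d :: "'o \<Rightarrow> real"
    and \<tau> \<tau>' \<tau>'' :: "'l \<Rightarrow> real \<Rightarrow> real"
    and \<theta> :: real +
  fixes hh :: "real^'n"
  assumes hh: "hh \<in> feasible od d"
    and fixpoint: "hh = logit_map \<theta> od (incidence route) \<tau> hh"
begin

definition p where "p = logit_choice \<theta> od (C hh)"
definition K where "K = reduced_jacobian \<theta> od D \<tau> \<tau>' hh"

lemma p_pos: "p $ i > 0"
  by (simp add: p_def logit_choice_pos)

lemma sum_p: "(\<Sum>i | od i = w. p $ i) = 1"
  by (simp add: p_def sum_logit_choice paths_nonempty)

lemma hh_nth: "hh $ i = d (od i) * p $ i"
proof -
  have "hh $ i = L hh $ i" by (rule arg_cong[OF fixpoint])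
  then show ?thesis by (simp add: logit_map_def demand_split_def p_def feasible_sum[OF hh])
qed

lemma hh_pos_iff: "hh $ i > 0 \<longleftrightarrow> d (od i) \<noteq> 0"
  using p_pos[of i] demand_nonneg[of "od i"] by (auto simp: hh_nth zero_less_mult_iff)

lemma demand_split_feasible: "h \<in> F \<Longrightarrow> demand_split od h x = (\<chi> i. d (od i) * x $ i)"
  by (simp add: demand_split_def feasible_sum)

lemma bounded_linear_demand_split: "bounded_linear (demand_split od hh)"
proof -
  have "linear (demand_split od hh)"
    by (rule linearI) (simp_all add: demand_split_def vec_eq_iff algebra_simps)
  then show ?thesis by (simp add: linear_conv_bounded_linear)
qed

lemma K_mult: "K *v v = demand_split od hh (logit_choice_deriv \<theta> od p (J hh *v v))"
  unfolding K_def reduced_jacobian_def Let_def p_def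
  by (simp add: matrix_vector_mul_assoc[symmetric] jacobian_mult[OF logit_choice_has_derivative]
      jacobian_mult[OF bounded_linear_imp_has_derivative[OF bounded_linear_demand_split]])

lemma K_mult_nth:
  "(K *v v) $ i = - \<theta> * hh $ i * ((J hh *v v) $ i - (\<Sum>j | od j = od i. p $ j * (J hh *v v) $ j))"
  unfolding K_mult demand_split_feasible[OF hh] by (simp add: logit_choice_deriv_def hh_nth)

text \<open>On feasible flows the OD totals are constant, so the first argument of
  \<open>demand_split\<close> may be frozen at \<open>hh\<close>. This is why the reduced Jacobian,
  without a derivative in that argument, linearizes \<open>L\<close> along \<open>F\<close>.\<close>

lemma quadratically_linearized_logit_map: "quadratically_linearized L (\<lambda>v. K *v v) hh F"
proof -
  have "quadratically_linearized (\<lambda>h. logit_choice \<theta> od (C h))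
      (\<lambda>v. logit_choice_deriv \<theta> od p (J hh *v v)) hh F"
    unfolding p_def
    by (intro quadratically_linearized_compose[OF quadratically_linearized_path_costs[OF hh]]
        bounded_feasible hh quadratically_linearized_logit_choice paths_nonempty theta_pos)
  from quadratically_linearized_compose[OF this bounded_feasible hh
      quadratically_linearized_linear[OF bounded_linear_demand_split]]
  show ?thesis
    by (rule quadratically_linearized_cong)
       (simp_all add: logit_map_def demand_split_feasible hh K_mult)
qed

text \<open>The second condition handles OD pairs without demand, where \<open>hh\<close> vanishes
  and the natural weight is undefined; all feasible flows agree there.\<close>

definition T :: "(real^'n) set" where
  "T = {x. (\<forall>w. (\<Sum>i | od i = w. x $ i) = 0) \<and> (\<forall>i. d (od i) = 0 \<longrightarrow> x $ i = 0)}"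

lemma subspace_T: "subspace T"
  unfolding subspace_def T_def by (auto simp: sum.distrib simp flip: sum_distrib_left)

lemma feasible_diff_in_T: "x \<in> F \<Longrightarrow> y \<in> F \<Longrightarrow> x - y \<in> T"
  using feasible_sum feasible_le feasible_nonneg
  by (auto simp: T_def sum_subtractf) (metis order_antisym)

text \<open>Stated for every \<open>v\<close>: hence eigenvectors for nonzero eigenvalues lie in
  \<open>T\<close>, and \<open>K\<close> is not surjective.\<close>

lemma K_in_T: "K *v v \<in> T"
proof -
  define m where "m w = (\<Sum>j | od j = w. p $ j * (J hh *v v) $ j)" for w
  have "(\<Sum>i | od i = w. (K *v v) $ i) = 0" for w
  proof -
    have "(\<Sum>i | od i = w. (K *v v) $ i) =
        (\<Sum>i | od i = w. - \<theta> * d w * (p $ i * (J hh *v v) $ i - p $ i * m w))"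
      by (rule sum.cong) (auto simp: K_mult_nth hh_nth m_def algebra_simps)
    also have "\<dots> = - \<theta> * d w * (m w - (\<Sum>i | od i = w. p $ i) * m w)"
      unfolding sum_distrib_left[symmetric] sum_subtractf sum_distrib_right[symmetric]
      by (simp add: m_def)
    finally show ?thesis by (simp add: sum_p)
  qed
  then show ?thesis by (simp add: T_def K_mult_nth hh_nth)
qed

text \<open>
  Weighting coordinate \<open>i\<close> by \<open>1 / (\<theta> * hh $ i)\<close> inverts \<open>- \<H>\<^sub>p' \<P>'\<close> on \<open>T\<close> and thereby turns \<open>- K\<close>
  into the quadratic form of the path cost Jacobian.
  Paths without demand carry no flow; their weight is irrelevant and only has to be positive.
\<close>

definition W where "W i = (if hh $ i > 0 then 1 / (\<theta> * hh $ i) else 1)"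
definition S :: "real^'n \<Rightarrow> real^'n" where "S x = (\<chi> i. sqrt (W i) * x $ i)"
definition A where "A v = - (K *v v)"

lemma W_pos: "W i > 0"
  using theta_pos by (simp add: W_def)

lemma inner_S: "S x \<bullet> S y = (\<Sum>i\<in>UNIV. W i * x $ i * y $ i)"
proof -
  have "sqrt (W i) * x $ i * (sqrt (W i) * y $ i) = W i * x $ i * y $ i" for i
  proof -
    have "sqrt (W i) * x $ i * (sqrt (W i) * y $ i) = (sqrt (W i) * sqrt (W i)) * x $ i * y $ i"
      by (simp only: mult.assoc mult.commute mult.left_commute)
    then show ?thesis using W_pos[of i] by simp
  qed
  then show ?thesis by (simp only: inner_vec_def S_def vec_lambda_beta inner_real_def)
qed

lemma linear_S: "linear S"
  by (rule linearI) (simp_all add: S_def vec_eq_iff algebra_simps)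

lemma inj_S: "inj S"
  using W_pos by (auto simp: linear_injective_0[OF linear_S] S_def vec_eq_iff) (metis less_irrefl)

lemma linear_A: "linear A"
  unfolding A_def by (intro linear_compose_neg) auto

text \<open>The weights cancel the factors of \<theta> and \<open>hh\<close>; the averaging term is
  constant on each OD pair and is annihilated by the zero sums of \<open>x\<close>.\<close>

lemma inner_S_A:
  assumes "x \<in> T"
  shows "S x \<bullet> S (A y) = x \<bullet> (J hh *v y)"
proof -
  define m where "m w = (\<Sum>j | od j = w. p $ j * (J hh *v y) $ j)" for w
  have "W i * x $ i * A y $ i = x $ i * (J hh *v y) $ i - x $ i * m (od i)" for i
  proof (cases "d (od i) = 0")
    case True
    then show ?thesis using assms by (simp add: T_def)
  next
    case False
    then have "hh $ i > 0" by (simp add: hh_pos_iff)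
    then show ?thesis
      using theta_pos by (simp add: A_def K_mult_nth W_def m_def field_simps)
  qed
  then have "S x \<bullet> S (A y) = x \<bullet> (J hh *v y) - (\<Sum>i\<in>UNIV. x $ i * m (od i))"
    by (simp add: inner_S inner_vec_def[of x] sum_subtractf)
  also have "(\<Sum>i\<in>UNIV. x $ i * m (od i)) = (\<Sum>w\<in>UNIV. \<Sum>i | od i = w. x $ i * m (od i))"
    using sum.group[of UNIV UNIV od "\<lambda>i. x $ i * m (od i)"] by simp
  also have "\<dots> = (\<Sum>w\<in>UNIV. (\<Sum>i | od i = w. x $ i) * m w)"
    unfolding sum_distrib_right by (intro sum.cong) auto
  also have "\<dots> = 0" using assms by (simp add: T_def)
  finally show ?thesis by simp
qed

sublocale symmetric_operator S A T
proof (rule symmetric_operator.intro[OF linear_S inj_S linear_A subspace_T])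
  show "S x \<bullet> S (A y) = S (A x) \<bullet> S y" if "x \<in> T" "y \<in> T" for x y
    using inner_S_A[OF that(1), of y] inner_S_A[OF that(2), of x] path_costs_jacobian_sym[of x hh y]
    by (simp add: inner_commute)
  show "A x \<in> T" for x
    unfolding A_def using K_in_T by (rule subspace_neg[OF subspace_T])
qed

lemma inner_S_A_nonneg: "x \<in> T \<Longrightarrow> 0 \<le> S x \<bullet> S (A x)"
  by (simp add: inner_S_A path_costs_jacobian_nonneg hh)

section \<open>Spectrum of the reduced Jacobian\<close>

lemma eigenvector_in_T:
  assumes "K *v v = x *\<^sub>R v" "x \<noteq> 0"
  shows "v \<in> T"
proof -
  have "v = (1 / x) *\<^sub>R (K *v v)" using assms by simp
  then show ?thesis using K_in_T subspace_T by (metis subspace_scale)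
qed

lemma eigenvalue_nonpos:
  assumes "x \<in> real_eigenvalues K"
  shows "x \<le> 0"
proof (rule ccontr)
  assume x: "\<not> x \<le> 0"
  obtain v where v: "v \<noteq> 0" "K *v v = x *\<^sub>R v" using assms by (auto simp: real_eigenvalues_def)
  have "v \<in> T" using eigenvector_in_T[OF v(2)] x by simp
  then have "0 \<le> S v \<bullet> S (A v)" by (rule inner_S_A_nonneg)
  also have "S v \<bullet> S (A v) = - x * (S v \<bullet> S v)"
    using v(2) by (simp add: A_def linear_scale[OF linear_S] linear_neg[OF linear_S])
  finally have "S v \<bullet> S v \<le> 0" using x by (simp add: mult_le_0_iff)
  then have "S v = 0" using inner_gt_zero_iff[of "S v"] by linarith
  then show False using v(1) by (simp add: S_eq_0_iff)
qed

text \<open>The range of \<open>K\<close> lies in \<open>T\<close>, which omits the all-ones vector.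
  A square matrix that is not surjective is not injective.\<close>

lemma zero_eigenvalue: "0 \<in> real_eigenvalues K"
proof (rule ccontr)
  assume "0 \<notin> real_eigenvalues K"
  then have "inj ((*v) K)"
    by (auto simp: real_eigenvalues_def linear_injective_0[OF matrix_vector_mul_linear])
  then have "surj ((*v) K)" by (rule linear_inj_imp_surj[OF matrix_vector_mul_linear])
  then obtain v where "(\<chi> i. 1) = K *v v" by (rule surjE)
  then have "(\<chi> i. 1) \<in> T" using K_in_T[of v] by simp
  then have "(\<Sum>i | od i = od j. (1::real)) = 0" for j by (simp add: T_def)
  then show False by (auto simp: card_eq_0_iff)
qed

text \<open>Eigenvectors for distinct nonzero eigenvalues are orthogonal in the weighted inner
  product, and a pairwise orthogonal set is finite. This gives \<open>Min\<close> its intended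
  meaning.\<close>

lemma finite_eigenvalues: "finite (real_eigenvalues K)"
proof -
  define E where "E = real_eigenvalues K - {0}"
  have "\<forall>x\<in>E. \<exists>v. v \<noteq> 0 \<and> K *v v = x *\<^sub>R v" by (auto simp: E_def real_eigenvalues_def)
  then obtain v where v: "\<And>x. x \<in> E \<Longrightarrow> v x \<noteq> 0" "\<And>x. x \<in> E \<Longrightarrow> K *v v x = x *\<^sub>R v x"
    by metis
  have vT: "v x \<in> T" if "x \<in> E" for x
    using eigenvector_in_T[OF v(2)[OF that]] that by (simp add: E_def)
  have orth: "S (v x) \<bullet> S (v y) = 0" if "x \<in> E" "y \<in> E" "x \<noteq> y" for x y
  proof -
    have "y * (S (v x) \<bullet> S (v y)) = x * (S (v x) \<bullet> S (v y))"
      using A_sym[OF vT[OF that(1)] vT[OF that(2)]] v(2)[OF that(1)] v(2)[OF that(2)]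
      by (simp add: A_def linear_scale[OF linear_S] linear_neg[OF linear_S])
    then show ?thesis using that(3) by simp
  qed
  have inj: "inj_on (\<lambda>x. S (v x)) E"
  proof (rule inj_onI, rule ccontr)
    fix x y assume *: "x \<in> E" "y \<in> E" "S (v x) = S (v y)" "x \<noteq> y"
    then have "S (v x) = 0" using orth[of x y] by simp
    then show False using v(1)[OF *(1)] by (simp add: S_eq_0_iff)
  qed
  have "pairwise orthogonal ((\<lambda>x. S (v x)) ` E)"
    using orth by (auto simp: pairwise_def orthogonal_def)
  then have "finite E"
    using pairwise_orthogonal_imp_finite finite_imageD inj by blast
  then show ?thesis by (simp add: E_def)
qed

definition lmin where "lmin = Min (real_eigenvalues K)"

lemma lmin_le: "x \<in> real_eigenvalues K \<Longrightarrow> lmin \<le> x"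
  by (simp add: lmin_def finite_eigenvalues)

lemma lmin_in: "lmin \<in> real_eigenvalues K"
  unfolding lmin_def using finite_eigenvalues zero_eigenvalue by (intro Min_in) auto

lemma lmin_nonpos: "lmin \<le> 0"
  using lmin_le zero_eigenvalue by blast

text \<open>The top eigenvector of \<open>A\<close> on \<open>T\<close> is an eigenvector of
  \<open>K\<close>, so its eigenvalue is at most - lmin.\<close>

lemma inner_S_A_le:
  assumes "x \<in> T"
  shows "S x \<bullet> S (A x) \<le> - lmin * (norm (S x))\<^sup>2"
proof (cases "T = {0}")
  case True
  then have "x = 0" using assms by simp
  then have "S x = 0" using linear_0[OF linear_S] by simp
  then show ?thesis by simp
next
  case False
  then obtain v \<mu> where v: "v \<noteq> 0" "A v = \<mu> *\<^sub>R v"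
    and le: "\<And>x. x \<in> T \<Longrightarrow> S x \<bullet> S (A x) \<le> \<mu> * (norm (S x))\<^sup>2"
    by (rule top_eigenvector) blast
  have "K *v v = (- \<mu>) *\<^sub>R v" using v(2) by (simp add: A_def minus_equation_iff[of "K *v v"])
  then have "- \<mu> \<in> real_eigenvalues K" using v(1) by (auto simp: real_eigenvalues_def)
  then have "\<mu> \<le> - lmin" using lmin_le by fastforce
  then have "\<mu> * (norm (S x))\<^sup>2 \<le> - lmin * (norm (S x))\<^sup>2" by (rule mult_right_mono) simp
  then show ?thesis using le[OF assms] by linarith
qed

text \<open>Where a vector of \<open>T\<close> can be nonzero, \<open>hh\<close> is at most the
  largest demand, so the weights are at least 1 / (\<theta> Max (range d)). This bounds the weighted
  Rayleigh quotient of an eigenvector for \<open>lmin\<close> by the Euclidean one of the path cost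
  Jacobian.\<close>

lemma lmin_ge: "- lmin \<le> \<theta> * Max (range d) * onorm ((*v) (J hh))"
proof -
  have dmax: "d w \<le> Max (range d)" for w by (rule Max_ge) auto
  have dmax0: "0 \<le> Max (range d)" using demand_nonneg dmax order_trans by blast
  have on: "0 \<le> onorm ((*v) (J hh))" by (intro onorm_pos_le matrix_vector_mul_bounded_linear)
  show ?thesis
  proof (cases "lmin = 0")
    case True
    then show ?thesis using dmax0 on theta_pos by simp
  next
    case False
    obtain v where v: "v \<noteq> 0" "K *v v = lmin *\<^sub>R v" using lmin_in by (auto simp: real_eigenvalues_def)
    have vT: "v \<in> T" using eigenvector_in_T[OF v(2) False] .
    have Sv: "0 < S v \<bullet> S v" using v(1) by (simp add: S_eq_0_iff)
    have "v $ i * v $ i \<le> \<theta> * Max (range d) * (W i * v $ i * v $ i)" for i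
    proof (cases "d (od i) = 0")
      case True
      then show ?thesis using vT by (simp add: T_def)
    next
      case False
      then have h: "hh $ i > 0" by (simp add: hh_pos_iff)
      have "hh $ i \<le> Max (range d)" using feasible_le[OF hh] dmax order_trans by blast
      then have "1 \<le> \<theta> * Max (range d) * W i" using h theta_pos by (simp add: W_def)
      then have "1 * (v $ i * v $ i) \<le> \<theta> * Max (range d) * W i * (v $ i * v $ i)"
        by (rule mult_right_mono) simp
      then show ?thesis by (simp add: mult.assoc)
    qed
    then have vS: "v \<bullet> v \<le> \<theta> * Max (range d) * (S v \<bullet> S v)"
      unfolding inner_S inner_vec_def[of v] sum_distrib_left by (intro sum_mono) simp
    have "- lmin * (S v \<bullet> S v) = S v \<bullet> S (A v)"
      using v(2) by (simp add: A_def linear_scale[OF linear_S] linear_neg[OF linear_S])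
    also have "\<dots> = v \<bullet> (J hh *v v)" by (rule inner_S_A[OF vT])
    also have "\<dots> \<le> norm v * norm (J hh *v v)" by (rule norm_cauchy_schwarz)
    also have "\<dots> \<le> norm v * (onorm ((*v) (J hh)) * norm v)"
      by (intro mult_left_mono onorm matrix_vector_mul_bounded_linear) auto
    also have "\<dots> = onorm ((*v) (J hh)) * (v \<bullet> v)"
      by (simp add: dot_square_norm power2_eq_square)
    also have "\<dots> \<le> onorm ((*v) (J hh)) * (\<theta> * Max (range d) * (S v \<bullet> S v))"
      using vS on by (rule mult_left_mono)
    finally have "- lmin * (S v \<bullet> S v) \<le> (\<theta> * Max (range d) * onorm ((*v) (J hh))) * (S v \<bullet> S v)"
      by (simp add: algebra_simps)
    then show ?thesis using Sv by (simp only: mult_le_cancel_right_pos)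
  qed
qed

lemma damped_fixpoint_iteration_logit_map:
  obtains c where "damped_fixpoint_iteration S A T (- lmin) L F hh c"
proof -
  obtain b where b: "b > 0" "\<And>x. N x \<le> b * norm x" by (rule N_le) blast
  obtain B where B: "B > 0" "\<And>x. norm x \<le> B * N x" by (rule le_N) blast
  obtain c where c: "c \<ge> 0" "\<And>x y. x \<in> F \<Longrightarrow> y \<in> F \<Longrightarrow>
      norm (L x - L y - K *v (x - y)) \<le> c * (norm (x - hh) + norm (y - hh)) * norm (x - y)"
    using quadratically_linearized_logit_map unfolding quadratically_linearized_def by blast
  \<comment> \<open>One \<open>b\<close> and two \<open>B\<close> come from changing norms in the
    three places; adding 1 ensures positivity.\<close>
  define c' where "c' = b * c * B * B + 1"
  have "damped_fixpoint_iteration S A T (- lmin) L F hh c'"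
  proof
    show "N (L x - L y + A (x - y)) \<le> c' * (N (x - hh) + N (y - hh)) * N (x - y)"
      if xy: "x \<in> F" "y \<in> F" for x y
    proof -
      have "N (L x - L y + A (x - y)) \<le> b * norm (L x - L y - K *v (x - y))"
        using b(2)[of "L x - L y + A (x - y)"] by (simp add: A_def)
      also have "\<dots> \<le> b * (c * (norm (x - hh) + norm (y - hh)) * norm (x - y))"
        using b c(2)[OF xy] by simp
      also have "\<dots> \<le> b * (c * (B * N (x - hh) + B * N (y - hh)) * (B * N (x - y)))"
        using b c(1) B by (intro mult_left_mono mult_mono add_mono mult_nonneg_nonneg) auto
      also have "\<dots> = (b * c * B * B) * ((N (x - hh) + N (y - hh)) * N (x - y))"
        by (simp add: algebra_simps)
      also have "\<dots> \<le> c' * ((N (x - hh) + N (y - hh)) * N (x - y))"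
        by (intro mult_right_mono) (auto simp: c'_def)
      finally show ?thesis by (simp add: mult.assoc)
    qed
    show "0 < c'" unfolding c'_def using b c(1) B by (intro add_nonneg_pos) auto
  qed (use inner_S_A_nonneg inner_S_A_le convex_feasible hh fixpoint logit_map_in feasible_diff_in_T in auto)
  then show ?thesis by (rule that)
qed

lemma relaxed_spectrum:
  assumes "0 < s"
  shows "real_eigenvalues ((1 - s) *\<^sub>R mat 1 + s *\<^sub>R K) = (\<lambda>x. 1 - s + s * x) ` real_eigenvalues K"
proof -
  have mult: "((1 - s) *\<^sub>R mat 1 + s *\<^sub>R K) *v v = (1 - s) *\<^sub>R v + s *\<^sub>R (K *v v)" for v
    by (simp add: matrix_vector_mult_add_rdistrib scaleR_matrix_vector_assoc[symmetric])
  have "(1 - s) *\<^sub>R v + s *\<^sub>R (K *v v) = x *\<^sub>R v \<longleftrightarrow> K *v v = ((x - (1 - s)) / s) *\<^sub>R v" for v x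
  proof -
    have "K *v v = ((x - (1 - s)) / s) *\<^sub>R v \<longleftrightarrow> s *\<^sub>R (K *v v) = s *\<^sub>R (((x - (1 - s)) / s) *\<^sub>R v)"
      using assms by (simp only: scaleR_cancel_left) simp
    also have "\<dots> \<longleftrightarrow> s *\<^sub>R (K *v v) = x *\<^sub>R v - (1 - s) *\<^sub>R v"
      using assms by (simp add: scaleR_diff_left[symmetric])
    finally show ?thesis by (simp add: eq_diff_eq add.commute)
  qed
  then have iff: "x \<in> real_eigenvalues ((1 - s) *\<^sub>R mat 1 + s *\<^sub>R K) \<longleftrightarrow>
      (x - (1 - s)) / s \<in> real_eigenvalues K" for x
    by (simp add: real_eigenvalues_def mult)
  show ?thesis
  proof (intro set_eqI iffI)
    fix x assume "x \<in> real_eigenvalues ((1 - s) *\<^sub>R mat 1 + s *\<^sub>R K)"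
    then show "x \<in> (\<lambda>x. 1 - s + s * x) ` real_eigenvalues K"
      using iff assms by (intro image_eqI[of _ _ "(x - (1 - s)) / s"]) auto
  qed (use iff assms in auto)
qed

text \<open>The value 1 - s comes from the eigenvalue 0. At the other end, 1 - s + s lmin > - (1 -
  s) is the step-size condition.\<close>

lemma spectral_radius:
  assumes "0 < s" "s < 1" "s * (2 - lmin) < 2"
  shows "Max (abs ` real_eigenvalues ((1 - s) *\<^sub>R mat 1 + s *\<^sub>R K)) = 1 - s"
proof (rule Max_eqI)
  show "finite (abs ` real_eigenvalues ((1 - s) *\<^sub>R mat 1 + s *\<^sub>R K))"
    using assms finite_eigenvalues by (simp add: relaxed_spectrum)
  show "1 - s \<in> abs ` real_eigenvalues ((1 - s) *\<^sub>R mat 1 + s *\<^sub>R K)"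
    unfolding relaxed_spectrum[OF assms(1)] image_image
    by (rule image_eqI[OF _ zero_eigenvalue]) (use assms in auto)
next
  fix y assume "y \<in> abs ` real_eigenvalues ((1 - s) *\<^sub>R mat 1 + s *\<^sub>R K)"
  then obtain x where x: "x \<in> real_eigenvalues K" "y = \<bar>1 - s + s * x\<bar>"
    using relaxed_spectrum[OF assms(1)] by auto
  have "s * x \<le> 0" using assms eigenvalue_nonpos[OF x(1)] by (simp add: mult_le_0_iff)
  moreover have "s * lmin \<le> s * x" using assms lmin_le[OF x(1)] by simp
  moreover have "2 * s - s * lmin < 2" using assms(3) by (simp add: algebra_simps)
  ultimately show "y \<le> 1 - s" unfolding x(2) by (intro abs_leI) linarith+
qed

text \<open>Coordinates with demand are positive at \<open>hh\<close>, hence at nearby feasible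
  flows, which leaves room for a short move. The direction has zero OD sums and vanishes in the
  remaining coordinates.\<close>

lemma feasible_direction:
  assumes "v \<in> F"
  obtains \<delta> where "\<delta> > 0" "\<And>h. h \<in> F \<Longrightarrow> h \<in> ball hh \<delta> \<Longrightarrow>
    \<exists>t0>0. \<forall>t. 0 < t \<and> t < t0 \<longrightarrow> h + t *\<^sub>R (v - hh) \<in> F"
proof -
  define P where "P = (\<Inter>i\<in>{i. d (od i) \<noteq> 0}. {h::real^'n. h $ i > 0})"
  have P: "open P"
    unfolding P_def by (intro open_INT) (auto intro!: open_Collect_less continuous_intros)
  have "hh \<in> P" by (auto simp: P_def hh_pos_iff)
  then obtain \<delta> where \<delta>: "\<delta> > 0" "ball hh \<delta> \<subseteq> P" using P open_contains_ball by blast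
  have "\<exists>t0>0. \<forall>t. 0 < t \<and> t < t0 \<longrightarrow> h + t *\<^sub>R (v - hh) \<in> F" if h: "h \<in> F" "h \<in> ball hh \<delta>" for h
  proof -
    have u: "v - hh \<in> T" using feasible_diff_in_T[OF assms hh] .
    have "\<forall>\<^sub>F t in at_right 0. h + t *\<^sub>R (v - hh) \<in> P"
    proof (rule topological_tendstoD[OF _ P])
      have "((\<lambda>t. h + t *\<^sub>R (v - hh)) \<longlongrightarrow> h + 0 *\<^sub>R (v - hh)) (at_right 0)"
        by (intro tendsto_intros)
      then show "((\<lambda>t. h + t *\<^sub>R (v - hh)) \<longlongrightarrow> h) (at_right 0)" by simp
      show "h \<in> P" using h(2) \<delta>(2) by blast
    qed
    then obtain t0 where t0: "t0 > 0" "\<And>t. 0 < t \<Longrightarrow> t < t0 \<Longrightarrow> h + t *\<^sub>R (v - hh) \<in> P"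
      by (auto simp: eventually_at_right[of 0 1])
    have "h + t *\<^sub>R (v - hh) \<in> F" if t: "0 < t" "t < t0" for t
    proof -
      define y where "y = h + t *\<^sub>R (v - hh)"
      have "0 \<le> y $ i" for i
      proof (cases "d (od i) = 0")
        case True
        then have "(v - hh) $ i = 0" using u by (simp add: T_def)
        then show ?thesis using feasible_nonneg[OF h(1), of i] by (simp add: y_def)
      next
        case False
        then show ?thesis using t0(2)[OF t] by (auto simp: P_def y_def intro: less_imp_le)
      qed
      moreover have "(\<Sum>i | od i = w. y $ i) = d w" for w
      proof -
        have "(\<Sum>i | od i = w. y $ i) =
            (\<Sum>i | od i = w. h $ i) + t * (\<Sum>i | od i = w. (v - hh) $ i)"
          by (simp add: y_def sum.distrib sum_distrib_left)
        also have "(\<Sum>i | od i = w. (v - hh) $ i) = 0" using u by (simp only: T_def mem_Collect_eq)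
        finally show ?thesis by (simp add: feasible_sum[OF h(1)])
      qed
      ultimately show ?thesis by (simp add: feasible_def y_def)
    qed
    then show ?thesis using t0(1) by blast
  qed
  with \<delta>(1) show ?thesis by (rule that)
qed

lemma kernel_rate:
  assumes s: "0 < s" "s < 1" "s * (2 - lmin) < 2"
    and v: "v \<in> F" "v \<noteq> hh" "K *v (v - hh) = 0"
  shows "\<exists>\<delta>>0. \<exists>U. open U \<and> F \<inter> ball hh \<delta> \<subseteq> closure (F \<inter> U) \<and>
    (\<forall>h0\<in>F \<inter> U \<inter> ball hh \<delta>. asymptotic_rate (msa L s h0) hh (1 - s))"
proof -
  obtain c where "damped_fixpoint_iteration S A T (- lmin) L F hh c"
    by (rule damped_fixpoint_iteration_logit_map)
  then interpret damped_fixpoint_iteration S A T "- lmin" L F hh c .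
  interpret damped_fixpoint_iteration_step S A T "- lmin" L F hh c s
    by unfold_locales (use s in auto)
  obtain \<delta> where "\<delta> > 0" "\<And>h. h \<in> F \<Longrightarrow> h \<in> ball hh \<delta> \<Longrightarrow>
      \<exists>t0>0. \<forall>t. 0 < t \<and> t < t0 \<longrightarrow> h + t *\<^sub>R (v - hh) \<in> F"
    using feasible_direction[OF v(1)] by blast
  with v show ?thesis
    by (intro generic_asymptotic_rate[of "v - hh" \<delta>]) (auto simp: A_def)
qed

lemma local_convergence:
  "\<exists>\<epsilon>>0. \<forall>s. 0 < s \<and> s < 1 \<and> s * (2 - lmin) < 2 \<longrightarrow>
     (\<forall>h0\<in>F \<inter> ball hh \<epsilon>. converges_linearly (msa L s h0) hh) \<and>
     (\<exists>C. \<forall>h0\<in>F \<inter> ball hh \<epsilon>. \<forall>k. norm (msa L s h0 k - hh) \<le> C * (1 - s) ^ k * norm (h0 - hh)) \<and>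
     (\<forall>h0\<in>F \<inter> ball hh \<epsilon>.
        asymptotic_rate (msa L s h0) hh (1 - s) \<or> converges_faster (msa L s h0) hh (1 - s))"
proof -
  obtain c where "damped_fixpoint_iteration S A T (- lmin) L F hh c"
    by (rule damped_fixpoint_iteration_logit_map)
  from damped_fixpoint_iteration.local_convergence[OF this] show ?thesis by simp
qed

lemma step_bound_le:
  "2 / (2 + \<theta> * Max (range d) * onorm ((*v) (J hh))) \<le> 2 / (2 - lmin)"
  using lmin_ge lmin_nonpos by (intro divide_left_mono) auto

end

text \<open>The alternative \<open>converges_faster\<close> is unavoidable: it covers h0 = hh, where
  every error ratio is 0 / 0, and all nearby orbits when \<open>K\<close> is injective on the
  feasible directions. So 1 - s appears as upper bound, as spectral radius and, given a kernel
  direction, as the limit ratio on a relatively open dense set of nearby starting points.\<close>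

theorem theorem2:
  fixes G :: "('v, 'l::finite) pre_digraph"
    and origin destination :: "'o::finite \<Rightarrow> 'v"
    and od :: "'n::finite \<Rightarrow> 'o"
    and route :: "'n \<Rightarrow> 'l list"
    and d :: "'o \<Rightarrow> real"
    and \<tau> \<tau>' \<tau>'' :: "'l \<Rightarrow> real \<Rightarrow> real"
    and \<theta> lmin s\<^sub>g s\<^sub>c :: real
    and D :: "real^'n^'l"
    and L :: "real^'n \<Rightarrow> real^'n"
    and K :: "real^'n^'n"
    and F :: "(real^'n) set"
    and hh :: "real^'n"
  assumes network: "logit_network G origin destination od route d \<tau> \<tau>' \<tau>'' \<theta>"
    and D: "D = incidence route"
    and F: "F = feasible od d"
    and L: "L = logit_map \<theta> od D \<tau>"
    and sue: "hh \<in> F" "hh = L hh"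
    and K: "K = reduced_jacobian \<theta> od D \<tau> \<tau>' hh"
    and lmin: "lmin = Min (real_eigenvalues K)"
    and s\<^sub>g: "s\<^sub>g = 2 / (2 - lmin)"
    and s\<^sub>c: "s\<^sub>c = 2 / (2 + \<theta> * Max (range d) * onorm ((*v) (path_costs_jacobian D \<tau>' hh)))"
  shows "s\<^sub>c \<le> s\<^sub>g \<and>
    (\<exists>\<epsilon>>0. \<forall>s. 0 < s \<and> s < 1 \<and> (s < s\<^sub>g \<or> s < s\<^sub>c) \<longrightarrow>
       (\<forall>h0\<in>F \<inter> ball hh \<epsilon>. converges_linearly (msa L s h0) hh) \<and>
       (\<exists>C. \<forall>h0\<in>F \<inter> ball hh \<epsilon>. \<forall>k.
          norm (msa L s h0 k - hh) \<le> C * (1 - s) ^ k * norm (h0 - hh)) \<and>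
       (\<forall>h0\<in>F \<inter> ball hh \<epsilon>.
          asymptotic_rate (msa L s h0) hh (1 - s) \<or>
          converges_faster (msa L s h0) hh (1 - s))) \<and>
    (\<forall>s. 0 < s \<and> s < 1 \<and> (s < s\<^sub>g \<or> s < s\<^sub>c) \<longrightarrow>
       Max (abs ` real_eigenvalues ((1 - s) *\<^sub>R mat 1 + s *\<^sub>R K)) = 1 - s \<and>
       ((\<exists>h\<in>F. h \<noteq> hh \<and> K *v (h - hh) = 0) \<longrightarrow>
        (\<exists>\<delta>>0. \<exists>U. open U \<and> F \<inter> ball hh \<delta> \<subseteq> closure (F \<inter> U) \<and>
           (\<forall>h0\<in>F \<inter> U \<inter> ball hh \<delta>. asymptotic_rate (msa L s h0) hh (1 - s)))))"
proof -
  let "_ \<and> (\<exists>\<epsilon>>0. \<forall>s. ?step s \<longrightarrow> ?conv \<epsilon> s) \<and> (\<forall>s. _ s \<longrightarrow> ?radius s \<and> (?dir \<longrightarrow> ?rate s))" = ?thesis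
  interpret e: logit_equilibrium G origin destination od route d \<tau> \<tau>' \<tau>'' \<theta> hh
    using network sue unfolding D F L by (intro logit_equilibrium.intro logit_equilibrium_axioms.intro)
  have K_eq: "e.K = K" by (simp add: e.K_def K D)
  have lmin_eq: "e.lmin = lmin" by (simp add: e.lmin_def K_eq lmin)
  have le: "s\<^sub>c \<le> s\<^sub>g"
    using e.step_bound_le unfolding lmin_eq s\<^sub>g s\<^sub>c D .
  have step: "0 < s \<and> s < 1 \<and> s * (2 - lmin) < 2" if "?step s" for s
  proof -
    have "s < 2 / (2 - lmin)" using that le unfolding s\<^sub>g by linarith
    then show ?thesis using that e.lmin_nonpos by (simp add: pos_less_divide_eq lmin_eq)
  qed
  have "\<exists>\<epsilon>>0. \<forall>s. 0 < s \<and> s < 1 \<and> s * (2 - lmin) < 2 \<longrightarrow> ?conv \<epsilon> s"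
    using e.local_convergence unfolding lmin_eq F L D .
  then obtain \<epsilon> where \<epsilon>: "0 < \<epsilon> \<and> (\<forall>s. 0 < s \<and> s < 1 \<and> s * (2 - lmin) < 2 \<longrightarrow> ?conv \<epsilon> s)"
    by (rule exE)
  have "?step s \<longrightarrow> ?conv \<epsilon> s" for s
    by (rule impI, rule conjunct2[OF \<epsilon>, THEN spec, THEN mp], rule step)
  then have conv: "\<exists>\<epsilon>>0. \<forall>s. ?step s \<longrightarrow> ?conv \<epsilon> s"
    by (intro exI[of _ \<epsilon>] conjI[OF conjunct1[OF \<epsilon>]] allI)
  have "?radius s \<and> (?dir \<longrightarrow> ?rate s)" if "?step s" for s
  proof (intro conjI impI)
    show "?radius s"
      using e.spectral_radius[of s] step[OF that] unfolding K_eq lmin_eq by blast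
    assume ?dir
    then obtain h where "h \<in> F" "h \<noteq> hh" "K *v (h - hh) = 0" by blast
    then show "?rate s"
      using e.kernel_rate[of s h] step[OF that] unfolding K_eq lmin_eq F L D by blast
  qed
  then have "\<forall>s. ?step s \<longrightarrow> ?radius s \<and> (?dir \<longrightarrow> ?rate s)"
    by (intro allI impI)
  with conv show ?thesis by (rule conjI[OF le conjI])
qed

end
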